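(* If $\Delta\,\mathcal R\,\Theta$ for some saturated bisimulation up-to $Cv\circ B$ $\mathcal R$, then $\Delta\sim_s\Theta$.
   Context: Notation. $\mathcal D(S)$: finitely supported probability distributions on $S$; $\overline{s}$: point distribution; $\sum_ip_i\bullet\Delta_i$: convex combination. Qubit names from a denumerable set $\mathcal Q$; $\mathcal H_\Sigma=(\mathbb C^2)^{\otimes|\Sigma|}$; superoperators $\rho\mapsto\sum_iE_i\rho E_i^\dagger$; measurements $\mathbb M=\{M_m\}$ with $\sum M_m^\dagger M_m=\mathbb I$, $\mathcal M_m(\sigma)=M_m\sigma M_m^\dagger$; $\mathcal E^{\tilde q}$ applies $\mathcal E$ to qubits $\tilde q$ and the identity elsewhere. Syntax (tagged lqCCS): tags $t\in\mathit{Tag}$; channels typed $\widehat{\mathbb N},\widehat{\mathbb B},\widehat{\mathcal Q}$; $P::=t:\tau.P\mid (t,t'):\tau.P\mid t:\mathcal E(\tilde e).P\mid t:\mathbb M(\tilde e\rhd x).P\mid t:c?x.P\mid \mathbf 0_{\tilde e}\mid t:c!e.P\mid \mathrm{if}\ e\ \mathrm{then}\ P\ \mathrm{else}\ P\mid P+P\mid P\parallel P\mid P\setminus c$ ($\mathcal E$ trace-preserving); expressions $e::=x\mid b\mid n\mid q\mid\neg e\mid e\lor e\mid e\le e\mid e=e$, evaluated by $e\Downarrow v$. Typing: $\Sigma\vdash\mathbf 0_{\tilde e}$ if $\tilde e$ enumerates $\Sigma$; prefixes $\tau$, classical send/receive, superoperator and measurement on $\tilde e$ (enumerating a subset of $\Sigma$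 of the right size), restriction keep $\Sigma$; sum and if-then-else need both branches typed by $\Sigma$; quantum receive $\Sigma\vdash t:c?x.P$ if $\Sigma\cup\{x\}\vdash P$; quantum send $\Sigma\vdash t:c!e.P$ if $e\in\Sigma$, $\Sigma\setminus\{e\}\vdash P$; $\Sigma_1\cup\Sigma_2\vdash P_1\parallel P_2$ if $\Sigma_1\cap\Sigma_2=\emptyset$, $\Sigma_i\vdash P_i$. Unique typing $\Sigma_P$. Configurations $\langle\rho,P\rangle$ ($\rho$ density operator on $\mathcal H_{\Sigma_\rho}$, $P$ closed), typed $(\Sigma_\rho,\Sigma_P)$ when $\Sigma_P\subseteq\Sigma_\rho$; $\mathit{Conf}_\bot=\mathit{Conf}\cup\{\bot\}$, $\bot$ typed by every pair; distributions typed if all support elements are. Only well-typed distributions are considered. Mass $|\Delta|=1-\Delta(\bot)$. Semantics: schedulers $s::=h\mid t\mid(t,t')$; actions $\tau,c!v,c?v$; transitions $\langle\rho,P\rangle\xrightarrow{\mu}_s\Delta$: least relation with $\langle\rho,t:\tau.P\rangle\xrightarrow{\tau}_t\overline{\langle\rho,P\rangle}$; $\langle\rho,(t,t'):\tau.P\rangle\xrightarrow{\tau}_{(t,t')}\overline{\langle\rho,P\rangle}$; $\langle\rho,t:c!e.P\rangle\xrightarrow{c!v}_t\overline{\langle\rho,P\rangle}$ if $e\Downarrow v$; $\langle\rho,t:c?x.P\rangle\xrightarrow{c?v}_t\overline{\langle\rho,P[v/x]\rangle}$ ($v\in\Sigma_\rho$ if quantum); $\langle\rho,t:\mathcal E(\tilde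 q).P\rangle\xrightarrow{\tau}_t\overline{\langle\mathcal E^{\tilde q}(\rho),P\rangle}$; $\langle\rho,t:\mathbb M(\tilde q\rhd y).P\rangle\xrightarrow{\tau}_t\sum_mp_m\bullet\overline{\langle\mathcal M^{\tilde q}_m(\rho)/p_m,P[m/y]\rangle}$, $p_m=\mathrm{tr}(\mathcal M^{\tilde q}_m(\rho))$; if-then-else follows the branch selected by $e$; $P+Q$ has the transitions of both; restriction passes actions other than $c!v,c?v$; $\langle\rho,P\parallel Q\rangle\xrightarrow{\mu}_s\Delta\parallel Q$ if $\langle\rho,P\rangle\xrightarrow{\mu}_s\Delta$ and $\mu$ is not $c?v$ with $v\in\Sigma_Q$ (and symmetrically); if $\langle\rho,P\rangle\xrightarrow{c!v}_t\overline{\langle\rho,P'\rangle}$, $\langle\rho,Q\rangle\xrightarrow{c?v}_{t'}\overline{\langle\rho,Q'\rangle}$ then $\langle\rho,P\parallel Q\rangle\xrightarrow{\tau}_{(t,t')}\overline{\langle\rho,P'\parallel Q'\rangle}$ and $\langle\rho,Q\parallel P\rangle\xrightarrow{\tau}_{(t,t')}\overline{\langle\rho,Q'\parallel P'\rangle}$. Lifting: on $\mathit{Conf}_\bot$, $\mathcal C\xrightarrow{\mu}_s\overline\bot$ is added whenever $\mathcal C$ (including $\bot$) has no $\xrightarrow{\mu}_s$ transition. For $\delta=\sum_jr_j\bullet\overline{s_j}$, $\mathcal C\xrightarrow{\mu}_\delta\sum_jr_j\bullet\Theta_j$ whenever $\mathcal C\xrightarrow{\mu}_{s_j}\Theta_j$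 for all $j$; for $\Delta=\sum_ip_i\bullet\overline{\mathcal C_i}$, $\Delta\xrightarrow{\mu}_\delta\sum_ip_i\bullet\Delta_i$ whenever $\mathcal C_i\xrightarrow{\mu}_\delta\Delta_i$ for all $i$. Standing assumption: deterministic tagging, i.e. $\Delta\xrightarrow{\mu}_\delta\Delta'$ and $\Delta\xrightarrow{\mu}_\delta\Delta''$ imply $\Delta'=\Delta''$. Contexts: $B[\cdot]_\Sigma=[\cdot]_\Sigma\parallel Q$, typed $\Sigma'\vdash B[\cdot]_\Sigma$ if $\Sigma\subseteq\Sigma'$ and $\Sigma'\setminus\Sigma\vdash Q$; $B[\langle\rho,P\rangle]=\langle\rho,P\parallel Q\rangle$, defined when $\Sigma_P=\Sigma$ and $\Sigma'\subseteq\Sigma_\rho$; $B[\bot]=\bot$; extended pointwise. Saturated bisimilarity $\sim_s$: largest relation $\mathcal R$ on $\mathcal D(\mathit{Conf}_\bot)$ such that $\Delta\mathcal R\Theta$ implies: both typed by the same $(\Sigma,\Sigma')$; $|\Delta|=|\Theta|$; for every context $B[\cdot]_{\Sigma'}$ and distribution of schedulers $\delta$, if $B[\Delta]\xrightarrow{\tau}_\delta\Delta'$ then $B[\Theta]\xrightarrow{\tau}_\delta\Theta'$ with $\Delta'\mathcal R\Theta'$, and symmetrically. Closures. For $\mathcal R\subseteq\mathcal D(\mathit{Conf}_\bot)^2$: the convex hull $Cv(\mathcal R)$ is the least relation containing $(\sum_{i\in I}p_i\bullet\Delta_i,\sum_{i\in I}p_i\bullet\Theta_i)$ whenever $\Delta_i\mathcal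 R\Theta_i$ for all $i$ in a finite $I$; the context closure $B(\mathcal R)$ is the least relation containing $(B[\Delta],B[\Theta])$ whenever $\Delta\mathcal R\Theta$, $\Delta,\Theta$ are typed by $\Sigma$ and $B[\cdot]$ has a hole of type $\Sigma$. A saturated bisimulation up-to $Cv\circ B$ is an $\mathcal R$ such that $\Delta\mathcal R\Theta$ implies: both typed by the same $(\Sigma,\Sigma')$; $|\Delta|=|\Theta|$; for every context $B[\cdot]$ and $\delta$, if $B[\Delta]\xrightarrow{\tau}_\delta\Delta'$ then $B[\Theta]\xrightarrow{\tau}_\delta\Theta'$ with $\Delta'\,Cv(B(\mathcal R))\,\Theta'$, and symmetrically. *)

theory Defs
  imports
    "HOL-Probability.Probability_Mass_Function"
    "Jordan_Normal_Form.Schur_Decomposition"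
begin

section \<open>Quantum states and operators\<close>

text \<open>
  Qubit names are natural numbers.  For a finite set \<open>S\<close> of names, the Hilbert space of \<open>S\<close> is
  the tensor product of \<open>card S\<close> copies of \<open>\<complex>\<^sup>2\<close>, with the factors ordered by increasing name.
  Its operators are square matrices of size \<open>2 ^ card S\<close> over the computational basis, whose
  vectors are numbered in binary, the leftmost tensor factor giving the most significant bit.
\<close>

type_synonym qubit = nat

definition mat_trace :: "complex mat \<Rightarrow> complex" where
  "mat_trace A = (\<Sum>i<dim_row A. A $$ (i, i))"

definition sum_mats :: "nat \<Rightarrow> complex mat list \<Rightarrow> complex mat" where
  "sum_mats d As = foldr (+) As (0\<^sub>m d d)"

definition positive_mat :: "complex mat \<Rightarrow> bool" where
  "positive_mat A \<longleftrightarrow> (\<forall>v \<in> carrier_vec (dim_row A). 0 \<le> (A *\<^sub>v v) \<bullet>c v)"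

definition density_operator :: "qubit set \<Rightarrow> complex mat \<Rightarrow> bool" where
  "density_operator S \<rho> \<longleftrightarrow>
     \<rho> \<in> carrier_mat (2 ^ card S) (2 ^ card S) \<and> positive_mat \<rho> \<and> mat_trace \<rho> = 1"

text \<open>
  The condition \<open>\<Sum>\<^sub>i E\<^sub>i\<^sup>\<dagger> E\<^sub>i = I\<close> on \<open>n\<close> qubits.  It makes a list of Kraus operators a
  trace-preserving superoperator, and a list of measurement operators (with outcomes
  \<open>0, 1, \<dots>\<close>) a measurement.
\<close>

definition complete_family :: "nat \<Rightarrow> complex mat list \<Rightarrow> bool" where
  "complete_family n Es \<longleftrightarrow>
     set Es \<subseteq> carrier_mat (2 ^ n) (2 ^ n) \<and>
     sum_mats (2 ^ n) (map (\<lambda>E. mat_adjoint E * E) Es) = 1\<^sub>m (2 ^ n)"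

text \<open>
  \<open>qubit_val S i q\<close> is the value of qubit \<open>q\<close> in the \<open>i\<close>-th basis vector of \<open>S\<close>: the number of
  names of \<open>S\<close> above \<open>q\<close> is the position of \<open>q\<close> counted from the least significant bit.
  \<open>sub_index S qs i\<close> is the number of the basis vector of \<open>length qs\<close> qubits obtained by reading
  off the values of \<open>qs\<close>, the head of \<open>qs\<close> being the leftmost factor.
\<close>

definition qubit_val :: "qubit set \<Rightarrow> nat \<Rightarrow> qubit \<Rightarrow> bool" where
  "qubit_val S i q = bit i (card {r \<in> S. q < r})"

definition sub_index :: "qubit set \<Rightarrow> qubit list \<Rightarrow> nat \<Rightarrow> nat" where
  "sub_index S qs i = horner_sum of_bool 2 (map (qubit_val S i) (rev qs))"

text \<open>\<open>K\<close> acting on the qubits \<open>qs\<close> of \<open>S\<close>, tensored with the identity on the others.\<close>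

definition lift_op :: "qubit set \<Rightarrow> qubit list \<Rightarrow> complex mat \<Rightarrow> complex mat" where
  "lift_op S qs K = mat (2 ^ card S) (2 ^ card S)
     (\<lambda>(i, j). if \<forall>q \<in> S - set qs. qubit_val S i q = qubit_val S j q
               then K $$ (sub_index S qs i, sub_index S qs j) else 0)"

definition sandwich :: "qubit set \<Rightarrow> qubit list \<Rightarrow> complex mat \<Rightarrow> complex mat \<Rightarrow> complex mat" where
  "sandwich S qs K \<rho> = lift_op S qs K * \<rho> * mat_adjoint (lift_op S qs K)"

definition apply_superop ::
    "qubit set \<Rightarrow> qubit list \<Rightarrow> complex mat list \<Rightarrow> complex mat \<Rightarrow> complex mat" where
  "apply_superop S qs Es \<rho> = sum_mats (2 ^ card S) (map (\<lambda>E. sandwich S qs E \<rho>) Es)"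


section \<open>Syntax\<close>

datatype ty = TNat | TBool | TQubit

datatype val = VNat nat | VBool bool | VQubit qubit

fun type_of_val :: "val \<Rightarrow> ty" where
  "type_of_val (VNat _) = TNat"
| "type_of_val (VBool _) = TBool"
| "type_of_val (VQubit _) = TQubit"

datatype var = MkVar (var_type: ty) nat

text \<open>The channel \<open>MkChan T n\<close> has type \<open>T\<close> with a hat: it carries values of type \<open>T\<close>.\<close>

datatype chan = MkChan (chan_type: ty) nat

datatype expr =
    EVar var
  | EVal val
  | ENot expr
  | EOr expr expr
  | ELe expr expr
  | EEq expr expr

text \<open>
  \<open>SuperOp t Es es P\<close> and \<open>Measure t Ms es y P\<close> carry the Kraus operators of the superoperator
  and the measurement operators, respectively; the requirement that they really form a
  trace-preserving superoperator or a measurement is imposed by the typing judgement below.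
  \<open>Discard es\<close> is the terminated process \<open>\<zero>\<^bsub>es\<^esub>\<close>.
\<close>

datatype 't proc =
    Tau 't "'t proc"
  | SyncTau 't 't "'t proc"
  | SuperOp 't "complex mat list" "expr list" "'t proc"
  | Measure 't "complex mat list" "expr list" var "'t proc"
  | Receive 't chan var "'t proc"
  | Discard "expr list"
  | Send 't chan expr "'t proc"
  | Cond expr "'t proc" "'t proc"
  | Choice "'t proc" "'t proc"
  | Par "'t proc" "'t proc"
  | Restrict "'t proc" chan

primrec fv_expr :: "expr \<Rightarrow> var set" where
  "fv_expr (EVar x) = {x}"
| "fv_expr (EVal v) = {}"
| "fv_expr (ENot e) = fv_expr e"
| "fv_expr (EOr e e') = fv_expr e \<union> fv_expr e'"
| "fv_expr (ELe e e') = fv_expr e \<union> fv_expr e'"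
| "fv_expr (EEq e e') = fv_expr e \<union> fv_expr e'"

primrec fv :: "'t proc \<Rightarrow> var set" where
  "fv (Tau t P) = fv P"
| "fv (SyncTau t t' P) = fv P"
| "fv (SuperOp t Es es P) = (\<Union>e \<in> set es. fv_expr e) \<union> fv P"
| "fv (Measure t Ms es y P) = (\<Union>e \<in> set es. fv_expr e) \<union> (fv P - {y})"
| "fv (Receive t c x P) = fv P - {x}"
| "fv (Discard es) = (\<Union>e \<in> set es. fv_expr e)"
| "fv (Send t c e P) = fv_expr e \<union> fv P"
| "fv (Cond e P Q) = fv_expr e \<union> fv P \<union> fv Q"
| "fv (Choice P Q) = fv P \<union> fv Q"
| "fv (Par P Q) = fv P \<union> fv Q"
| "fv (Restrict P c) = fv P"

definition closed_proc :: "'t proc \<Rightarrow> bool" where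
  "closed_proc P \<longleftrightarrow> fv P = {}"

text \<open>Only (closed) values are ever substituted, so no variable can be captured.\<close>

primrec subst_expr :: "var \<Rightarrow> val \<Rightarrow> expr \<Rightarrow> expr" where
  "subst_expr x v (EVar y) = (if y = x then EVal v else EVar y)"
| "subst_expr x v (EVal w) = EVal w"
| "subst_expr x v (ENot e) = ENot (subst_expr x v e)"
| "subst_expr x v (EOr e e') = EOr (subst_expr x v e) (subst_expr x v e')"
| "subst_expr x v (ELe e e') = ELe (subst_expr x v e) (subst_expr x v e')"
| "subst_expr x v (EEq e e') = EEq (subst_expr x v e) (subst_expr x v e')"

primrec subst :: "var \<Rightarrow> val \<Rightarrow> 't proc \<Rightarrow> 't proc" where
  "subst x v (Tau t P) = Tau t (subst x v P)"
| "subst x v (SyncTau t t' P) = SyncTau t t' (subst x v P)"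
| "subst x v (SuperOp t Es es P) = SuperOp t Es (map (subst_expr x v) es) (subst x v P)"
| "subst x v (Measure t Ms es y P) =
     Measure t Ms (map (subst_expr x v) es) y (if y = x then P else subst x v P)"
| "subst x v (Receive t c y P) = Receive t c y (if y = x then P else subst x v P)"
| "subst x v (Discard es) = Discard (map (subst_expr x v) es)"
| "subst x v (Send t c e P) = Send t c (subst_expr x v e) (subst x v P)"
| "subst x v (Cond e P Q) = Cond (subst_expr x v e) (subst x v P) (subst x v Q)"
| "subst x v (Choice P Q) = Choice (subst x v P) (subst x v Q)"
| "subst x v (Par P Q) = Par (subst x v P) (subst x v Q)"
| "subst x v (Restrict P c) = Restrict (subst x v P) c"

inductive evaluates :: "expr \<Rightarrow> val \<Rightarrow> bool" (infix "\<Down>" 50) where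
  "EVal v \<Down> v"
| "e \<Down> VBool b \<Longrightarrow> ENot e \<Down> VBool (\<not> b)"
| "e \<Down> VBool b \<Longrightarrow> e' \<Down> VBool b' \<Longrightarrow> EOr e e' \<Down> VBool (b \<or> b')"
| "e \<Down> VNat m \<Longrightarrow> e' \<Down> VNat n \<Longrightarrow> ELe e e' \<Down> VBool (m \<le> n)"
| "e \<Down> v \<Longrightarrow> e' \<Down> v' \<Longrightarrow> type_of_val v = type_of_val v' \<Longrightarrow> EEq e e' \<Down> VBool (v = v')"


section \<open>Typing\<close>

inductive expr_type :: "expr \<Rightarrow> ty \<Rightarrow> bool" where
  "expr_type (EVar x) (var_type x)"
| "expr_type (EVal v) (type_of_val v)"
| "expr_type e TBool \<Longrightarrow> expr_type (ENot e) TBool"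
| "expr_type e TBool \<Longrightarrow> expr_type e' TBool \<Longrightarrow> expr_type (EOr e e') TBool"
| "expr_type e TNat \<Longrightarrow> expr_type e' TNat \<Longrightarrow> expr_type (ELe e e') TBool"
| "expr_type e T \<Longrightarrow> expr_type e' T \<Longrightarrow> expr_type (EEq e e') TBool"

text \<open>
  A type \<open>\<Sigma>\<close> is a set of qubit names and qubit variables, both seen as expressions.
  In the rule for quantum reception, \<open>EVar x \<notin> \<Sigma>\<close> is the convention that a binder does not
  shadow a variable in use; without it a process would not have a unique type.
\<close>

definition qubit_atoms :: "expr set" where
  "qubit_atoms = {EVal (VQubit q) | q. True} \<union> {EVar x | x. var_type x = TQubit}"

inductive has_type :: "expr set \<Rightarrow> 't proc \<Rightarrow> bool" (infix "\<turnstile>" 50) where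
  t_discard: "distinct es \<Longrightarrow> set es = \<Sigma> \<Longrightarrow> \<Sigma> \<subseteq> qubit_atoms \<Longrightarrow> \<Sigma> \<turnstile> Discard es"
| t_tau: "\<Sigma> \<turnstile> P \<Longrightarrow> \<Sigma> \<turnstile> Tau t P"
| t_sync_tau: "\<Sigma> \<turnstile> P \<Longrightarrow> \<Sigma> \<turnstile> SyncTau t t' P"
| t_superop: "distinct es \<Longrightarrow> set es \<subseteq> \<Sigma> \<Longrightarrow> complete_family (length es) Es \<Longrightarrow> \<Sigma> \<turnstile> P \<Longrightarrow>
    \<Sigma> \<turnstile> SuperOp t Es es P"
| t_measure: "distinct es \<Longrightarrow> set es \<subseteq> \<Sigma> \<Longrightarrow> complete_family (length es) Ms \<Longrightarrow>
    var_type y = TNat \<Longrightarrow> \<Sigma> \<turnstile> P \<Longrightarrow> \<Sigma> \<turnstile> Measure t Ms es y P"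
| t_receive: "chan_type c \<noteq> TQubit \<Longrightarrow> var_type x = chan_type c \<Longrightarrow> \<Sigma> \<turnstile> P \<Longrightarrow>
    \<Sigma> \<turnstile> Receive t c x P"
| t_qreceive: "chan_type c = TQubit \<Longrightarrow> var_type x = TQubit \<Longrightarrow> EVar x \<notin> \<Sigma> \<Longrightarrow>
    \<Sigma> \<union> {EVar x} \<turnstile> P \<Longrightarrow> \<Sigma> \<turnstile> Receive t c x P"
| t_send: "chan_type c \<noteq> TQubit \<Longrightarrow> expr_type e (chan_type c) \<Longrightarrow> \<Sigma> \<turnstile> P \<Longrightarrow> \<Sigma> \<turnstile> Send t c e P"
| t_qsend: "chan_type c = TQubit \<Longrightarrow> e \<in> qubit_atoms \<Longrightarrow> e \<in> \<Sigma> \<Longrightarrow> \<Sigma> - {e} \<turnstile> P \<Longrightarrow>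
    \<Sigma> \<turnstile> Send t c e P"
| t_cond: "expr_type e TBool \<Longrightarrow> \<Sigma> \<turnstile> P \<Longrightarrow> \<Sigma> \<turnstile> Q \<Longrightarrow> \<Sigma> \<turnstile> Cond e P Q"
| t_choice: "\<Sigma> \<turnstile> P \<Longrightarrow> \<Sigma> \<turnstile> Q \<Longrightarrow> \<Sigma> \<turnstile> Choice P Q"
| t_par: "\<Sigma>\<^sub>1 \<turnstile> P \<Longrightarrow> \<Sigma>\<^sub>2 \<turnstile> Q \<Longrightarrow> \<Sigma>\<^sub>1 \<inter> \<Sigma>\<^sub>2 = {} \<Longrightarrow> \<Sigma>\<^sub>1 \<union> \<Sigma>\<^sub>2 \<turnstile> Par P Q"
| t_restrict: "\<Sigma> \<turnstile> P \<Longrightarrow> \<Sigma> \<turnstile> Restrict P c"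

abbreviation names :: "qubit set \<Rightarrow> expr set" where
  "names S \<equiv> (\<lambda>q. EVal (VQubit q)) ` S"

datatype 't conf = Conf "qubit set" "complex mat" "'t proc"

fun conf_typed :: "qubit set \<Rightarrow> qubit set \<Rightarrow> 't conf \<Rightarrow> bool" where
  "conf_typed \<Sigma> \<Sigma>' (Conf S \<rho> P) \<longleftrightarrow>
     finite S \<and> density_operator S \<rho> \<and> closed_proc P \<and> S = \<Sigma> \<and> names \<Sigma>' \<turnstile> P \<and> \<Sigma>' \<subseteq> \<Sigma>"

text \<open>Elements of \<open>Conf\<^sub>\<bottom>\<close> are options, \<open>None\<close> being \<open>\<bottom>\<close>; distributions have finite support.\<close>

type_synonym 't dist = "'t conf option pmf"

definition dist_typed :: "qubit set \<Rightarrow> qubit set \<Rightarrow> 't dist \<Rightarrow> bool" where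
  "dist_typed \<Sigma> \<Sigma>' \<Delta> \<longleftrightarrow> (\<forall>C. Some C \<in> set_pmf \<Delta> \<longrightarrow> conf_typed \<Sigma> \<Sigma>' C)"

definition mass :: "'t dist \<Rightarrow> real" where
  "mass \<Delta> = 1 - pmf \<Delta> None"


section \<open>Semantics\<close>

datatype 't sched = Halt | One 't | Two 't 't

datatype act = ATau | ASend chan val | ARecv chan val

fun par_right :: "'t proc \<Rightarrow> 't conf \<Rightarrow> 't conf" where
  "par_right Q (Conf S \<rho> P) = Conf S \<rho> (Par P Q)"

fun par_left :: "'t proc \<Rightarrow> 't conf \<Rightarrow> 't conf" where
  "par_left Q (Conf S \<rho> P) = Conf S \<rho> (Par Q P)"

fun restrict_conf :: "chan \<Rightarrow> 't conf \<Rightarrow> 't conf" where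
  "restrict_conf c (Conf S \<rho> P) = Conf S \<rho> (Restrict P c)"

text \<open>
  In the measurement rule, \<open>J\<close> is the distribution of outcomes.  Outcomes of probability \<open>0\<close> are
  outside its support and thus contribute nothing to the target.
\<close>

inductive step :: "'t conf \<Rightarrow> act \<Rightarrow> 't sched \<Rightarrow> 't conf pmf \<Rightarrow> bool" where
  s_tau: "step (Conf S \<rho> (Tau t P)) ATau (One t) (return_pmf (Conf S \<rho> P))"
| s_sync_tau: "step (Conf S \<rho> (SyncTau t t' P)) ATau (Two t t') (return_pmf (Conf S \<rho> P))"
| s_send: "e \<Down> v \<Longrightarrow>
    step (Conf S \<rho> (Send t c e P)) (ASend c v) (One t) (return_pmf (Conf S \<rho> P))"
| s_receive: "type_of_val v = chan_type c \<Longrightarrow> (\<forall>q. v = VQubit q \<longrightarrow> q \<in> S) \<Longrightarrow>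
    step (Conf S \<rho> (Receive t c x P)) (ARecv c v) (One t) (return_pmf (Conf S \<rho> (subst x v P)))"
| s_superop:
    "step (Conf S \<rho> (SuperOp t Es (map (\<lambda>q. EVal (VQubit q)) qs) P)) ATau (One t)
       (return_pmf (Conf S (apply_superop S qs Es \<rho>) P))"
| s_measure:
    "set_pmf J \<subseteq> {..<length Ms} \<Longrightarrow>
     (\<forall>m < length Ms. complex_of_real (pmf J m) = mat_trace (sandwich S qs (Ms ! m) \<rho>)) \<Longrightarrow>
     step (Conf S \<rho> (Measure t Ms (map (\<lambda>q. EVal (VQubit q)) qs) y P)) ATau (One t)
       (map_pmf (\<lambda>m. Conf S (complex_of_real (1 / pmf J m) \<cdot>\<^sub>m sandwich S qs (Ms ! m) \<rho>)
                            (subst y (VNat m) P)) J)"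
| s_cond_true: "e \<Down> VBool True \<Longrightarrow> step (Conf S \<rho> P) \<mu> s \<Delta> \<Longrightarrow> step (Conf S \<rho> (Cond e P Q)) \<mu> s \<Delta>"
| s_cond_false: "e \<Down> VBool False \<Longrightarrow> step (Conf S \<rho> Q) \<mu> s \<Delta> \<Longrightarrow> step (Conf S \<rho> (Cond e P Q)) \<mu> s \<Delta>"
| s_choice_left: "step (Conf S \<rho> P) \<mu> s \<Delta> \<Longrightarrow> step (Conf S \<rho> (Choice P Q)) \<mu> s \<Delta>"
| s_choice_right: "step (Conf S \<rho> Q) \<mu> s \<Delta> \<Longrightarrow> step (Conf S \<rho> (Choice P Q)) \<mu> s \<Delta>"
| s_restrict: "step (Conf S \<rho> P) \<mu> s \<Delta> \<Longrightarrow> (\<forall>v. \<mu> \<noteq> ASend c v \<and> \<mu> \<noteq> ARecv c v) \<Longrightarrow>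
    step (Conf S \<rho> (Restrict P c)) \<mu> s (map_pmf (restrict_conf c) \<Delta>)"
| s_par_left: "step (Conf S \<rho> P) \<mu> s \<Delta> \<Longrightarrow> \<Sigma> \<turnstile> Q \<Longrightarrow>
    (\<forall>c v. \<mu> = ARecv c v \<longrightarrow> EVal v \<notin> \<Sigma>) \<Longrightarrow>
    step (Conf S \<rho> (Par P Q)) \<mu> s (map_pmf (par_right Q) \<Delta>)"
| s_par_right: "step (Conf S \<rho> P) \<mu> s \<Delta> \<Longrightarrow> \<Sigma> \<turnstile> Q \<Longrightarrow>
    (\<forall>c v. \<mu> = ARecv c v \<longrightarrow> EVal v \<notin> \<Sigma>) \<Longrightarrow>
    step (Conf S \<rho> (Par Q P)) \<mu> s (map_pmf (par_left Q) \<Delta>)"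
| s_comm_left:
    "step (Conf S \<rho> P) (ASend c v) (One t) (return_pmf (Conf S \<rho> P')) \<Longrightarrow>
     step (Conf S \<rho> Q) (ARecv c v) (One t') (return_pmf (Conf S \<rho> Q')) \<Longrightarrow>
     step (Conf S \<rho> (Par P Q)) ATau (Two t t') (return_pmf (Conf S \<rho> (Par P' Q')))"
| s_comm_right:
    "step (Conf S \<rho> P) (ASend c v) (One t) (return_pmf (Conf S \<rho> P')) \<Longrightarrow>
     step (Conf S \<rho> Q) (ARecv c v) (One t') (return_pmf (Conf S \<rho> Q')) \<Longrightarrow>
     step (Conf S \<rho> (Par Q P)) ATau (Two t t') (return_pmf (Conf S \<rho> (Par Q' P')))"

inductive bot_step :: "'t conf option \<Rightarrow> act \<Rightarrow> 't sched \<Rightarrow> 't dist \<Rightarrow> bool" where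
  bs_step: "step C \<mu> s \<Delta> \<Longrightarrow> bot_step (Some C) \<mu> s (map_pmf Some \<Delta>)"
| bs_bot: "(\<nexists>C \<Delta>. X = Some C \<and> step C \<mu> s \<Delta>) \<Longrightarrow> bot_step X \<mu> s (return_pmf None)"

text \<open>
  Finite convex combinations \<open>\<Sum>\<^sub>i p\<^sub>i \<bullet> \<Delta>\<^sub>i\<close> are written \<open>bind_pmf I \<Delta>\<close> for a distribution \<open>I\<close>
  of finite support on indices; \<open>\<Sum>\<^sub>i p\<^sub>i \<bullet> point(x\<^sub>i)\<close> is then \<open>map_pmf x I\<close>.  The points
  \<open>x\<^sub>i\<close> need not be distinct.
\<close>

inductive sched_step :: "'t conf option \<Rightarrow> act \<Rightarrow> 't sched pmf \<Rightarrow> 't dist \<Rightarrow> bool" where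
  "finite (set_pmf (J :: nat pmf)) \<Longrightarrow> (\<forall>j \<in> set_pmf J. bot_step X \<mu> (s j) (\<Theta> j)) \<Longrightarrow>
   sched_step X \<mu> (map_pmf s J) (bind_pmf J \<Theta>)"

inductive dist_step :: "'t dist \<Rightarrow> act \<Rightarrow> 't sched pmf \<Rightarrow> 't dist \<Rightarrow> bool" where
  "finite (set_pmf (I :: nat pmf)) \<Longrightarrow> (\<forall>i \<in> set_pmf I. sched_step (X i) \<mu> \<delta> (\<Theta> i)) \<Longrightarrow>
   dist_step (map_pmf X I) \<mu> \<delta> (bind_pmf I \<Theta>)"


section \<open>Admissible distributions\<close>

text \<open>
  Deterministic tagging restricts the distributions under consideration, which must be closed
  under transitions: every distribution over \<open>\<bottom>\<close> and the (well-typed) configurations reachable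
  from \<open>\<Delta>\<close> has at most one derivative for each action and each distribution of schedulers.
\<close>

inductive reachable :: "'t conf \<Rightarrow> 't conf \<Rightarrow> bool" where
  "reachable C C"
| "reachable C C' \<Longrightarrow> step C' \<mu> s \<Delta> \<Longrightarrow> C'' \<in> set_pmf \<Delta> \<Longrightarrow> conf_typed \<Sigma> \<Sigma>' C'' \<Longrightarrow> reachable C C''"

definition deterministic :: "'t dist \<Rightarrow> bool" where
  "deterministic \<Delta> \<longleftrightarrow>
     (\<forall>\<mu> \<delta> \<Delta>' \<Delta>''. dist_step \<Delta> \<mu> \<delta> \<Delta>' \<longrightarrow> dist_step \<Delta> \<mu> \<delta> \<Delta>'' \<longrightarrow> \<Delta>' = \<Delta>'')"

definition deterministically_tagged :: "'t dist \<Rightarrow> bool" where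
  "deterministically_tagged \<Delta> \<longleftrightarrow>
     (\<forall>\<Theta>. finite (set_pmf \<Theta>) \<longrightarrow>
          (\<forall>C'. Some C' \<in> set_pmf \<Theta> \<longrightarrow> (\<exists>C. Some C \<in> set_pmf \<Delta> \<and> reachable C C')) \<longrightarrow>
          deterministic \<Theta>)"

definition admissible :: "'t dist \<Rightarrow> bool" where
  "admissible \<Delta> \<longleftrightarrow>
     finite (set_pmf \<Delta>) \<and> (\<exists>\<Sigma> \<Sigma>'. dist_typed \<Sigma> \<Sigma>' \<Delta>) \<and> deterministically_tagged \<Delta>"


section \<open>Contexts and saturated bisimilarity\<close>

text \<open>The context \<open>Ctx \<Sigma> Q\<close> is \<open>[\<cdot>] \<parallel> Q\<close> with a hole of type \<open>\<Sigma>\<close>.\<close>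

datatype 't ctx = Ctx "qubit set" "'t proc"

fun ctx_typed :: "qubit set \<Rightarrow> 't ctx \<Rightarrow> bool" where
  "ctx_typed \<Sigma>' (Ctx \<Sigma> Q) \<longleftrightarrow> \<Sigma> \<subseteq> \<Sigma>' \<and> closed_proc Q \<and> names (\<Sigma>' - \<Sigma>) \<turnstile> Q"

fun plug :: "'t ctx \<Rightarrow> 't dist \<Rightarrow> 't dist" where
  "plug (Ctx \<Sigma> Q) \<Delta> = map_pmf (map_option (par_right Q)) \<Delta>"

fun hole_fits :: "'t ctx \<Rightarrow> qubit set \<Rightarrow> 't conf \<Rightarrow> bool" where
  "hole_fits (Ctx \<Sigma> Q) \<Sigma>' (Conf S \<rho> P) \<longleftrightarrow> names \<Sigma> \<turnstile> P \<and> \<Sigma>' \<subseteq> S"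

text \<open>
  \<open>B[\<Delta>]\<close> is defined: the context is typed, its hole has the type of every configuration in the
  support of \<open>\<Delta>\<close> (and every hole suits \<open>\<bottom>\<close>), and the result is again admissible; in particular
  the tags of the context do not break the determinism of \<open>\<Delta>\<close>.
\<close>

definition plug_defined :: "'t ctx \<Rightarrow> 't dist \<Rightarrow> bool" where
  "plug_defined B \<Delta> \<longleftrightarrow>
     (\<exists>\<Sigma>'. ctx_typed \<Sigma>' B \<and> (\<forall>C. Some C \<in> set_pmf \<Delta> \<longrightarrow> hole_fits B \<Sigma>' C)) \<and>
     admissible (plug B \<Delta>)"

type_synonym 't dist_rel = "'t dist \<Rightarrow> 't dist \<Rightarrow> bool"

inductive convex_hull :: "'t dist_rel \<Rightarrow> 't dist_rel" for R :: "'t dist_rel" where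
  "finite (set_pmf (I :: nat pmf)) \<Longrightarrow> (\<forall>i \<in> set_pmf I. R (\<Delta> i) (\<Theta> i)) \<Longrightarrow>
   convex_hull R (bind_pmf I \<Delta>) (bind_pmf I \<Theta>)"

inductive context_closure :: "'t dist_rel \<Rightarrow> 't dist_rel" for R :: "'t dist_rel" where
  "R \<Delta> \<Theta> \<Longrightarrow> plug_defined B \<Delta> \<Longrightarrow> plug_defined B \<Theta> \<Longrightarrow>
   context_closure R (plug B \<Delta>) (plug B \<Theta>)"

text \<open>
  The clauses shared by saturated bisimulations and their up-to variant, for a single pair:
  placed in any context, \<open>\<Delta>\<close> and \<open>\<Theta>\<close> evolve into pairs related by \<open>R\<close>.
\<close>

definition progress :: "'t dist_rel \<Rightarrow> 't dist_rel" where
  "progress R \<Delta> \<Theta> \<longleftrightarrow>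
     admissible \<Delta> \<and> admissible \<Theta> \<and>
     (\<exists>\<Sigma> \<Sigma>'. dist_typed \<Sigma> \<Sigma>' \<Delta> \<and> dist_typed \<Sigma> \<Sigma>' \<Theta>) \<and>
     mass \<Delta> = mass \<Theta> \<and>
     (\<forall>B \<delta>. plug_defined B \<Delta> \<longrightarrow> plug_defined B \<Theta> \<longrightarrow>
        (\<forall>\<Delta>'. dist_step (plug B \<Delta>) ATau \<delta> \<Delta>' \<longrightarrow>
               (\<exists>\<Theta>'. dist_step (plug B \<Theta>) ATau \<delta> \<Theta>' \<and> R \<Delta>' \<Theta>')) \<and>
        (\<forall>\<Theta>'. dist_step (plug B \<Theta>) ATau \<delta> \<Theta>' \<longrightarrow>
               (\<exists>\<Delta>'. dist_step (plug B \<Delta>) ATau \<delta> \<Delta>' \<and> R \<Delta>' \<Theta>')))"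

definition saturated_bisimulation :: "'t dist_rel \<Rightarrow> bool" where
  "saturated_bisimulation R \<longleftrightarrow> (\<forall>\<Delta> \<Theta>. R \<Delta> \<Theta> \<longrightarrow> progress R \<Delta> \<Theta>)"

definition saturated_bisimulation_upto_Cv_B :: "'t dist_rel \<Rightarrow> bool" where
  "saturated_bisimulation_upto_Cv_B R \<longleftrightarrow>
     (\<forall>\<Delta> \<Theta>. R \<Delta> \<Theta> \<longrightarrow> progress (convex_hull (context_closure R)) \<Delta> \<Theta>)"

definition saturated_bisimilar :: "'t dist_rel" (infix "\<sim>\<^sub>s" 50) where
  "\<Delta> \<sim>\<^sub>s \<Theta> \<longleftrightarrow> (\<exists>R. saturated_bisimulation R \<and> R \<Delta> \<Theta>)"

text \<open>The union of all saturated bisimulations is the largest one.\<close>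

lemma progress_mono:
  assumes "R \<le> R'"
  shows "progress R \<le> progress R'"
proof (rule predicate2I)
  fix \<Delta> \<Theta>
  assume "progress R \<Delta> \<Theta>"
  note p = this[unfolded progress_def]
  note clauses = p[THEN conjunct2, THEN conjunct2, THEN conjunct2, THEN conjunct2]
  show "progress R' \<Delta> \<Theta>"
    unfolding progress_def
  proof (intro conjI allI impI)
    show "admissible \<Delta>" "admissible \<Theta>" "mass \<Delta> = mass \<Theta>"
      using p by simp_all
    show "\<exists>\<Sigma> \<Sigma>'. dist_typed \<Sigma> \<Sigma>' \<Delta> \<and> dist_typed \<Sigma> \<Sigma>' \<Theta>"
      by (rule p[THEN conjunct2, THEN conjunct2, THEN conjunct1])
  next
    fix B \<delta> \<Delta>'
    assume "plug_defined B \<Delta>" "plug_defined B \<Theta>" "dist_step (plug B \<Delta>) ATau \<delta> \<Delta>'"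
    from clauses[THEN spec, THEN spec, THEN mp, OF this(1), THEN mp, OF this(2),
        THEN conjunct1, THEN spec, THEN mp, OF this(3)]
    obtain \<Theta>' where "dist_step (plug B \<Theta>) ATau \<delta> \<Theta>'" "R \<Delta>' \<Theta>'"
      by (elim exE conjE)
    with assms show "\<exists>\<Theta>'. dist_step (plug B \<Theta>) ATau \<delta> \<Theta>' \<and> R' \<Delta>' \<Theta>'"
      by (intro exI conjI) (auto dest: predicate2D)
  next
    fix B \<delta> \<Theta>'
    assume "plug_defined B \<Delta>" "plug_defined B \<Theta>" "dist_step (plug B \<Theta>) ATau \<delta> \<Theta>'"
    from clauses[THEN spec, THEN spec, THEN mp, OF this(1), THEN mp, OF this(2),
        THEN conjunct2, THEN spec, THEN mp, OF this(3)]
    obtain \<Delta>' where "dist_step (plug B \<Delta>) ATau \<delta> \<Delta>'" "R \<Delta>' \<Theta>'"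
      by (elim exE conjE)
    with assms show "\<exists>\<Delta>'. dist_step (plug B \<Delta>) ATau \<delta> \<Delta>' \<and> R' \<Delta>' \<Theta>'"
      by (intro exI conjI) (auto dest: predicate2D)
  qed
qed

lemma saturated_bisimilar_greatest: "saturated_bisimulation R \<Longrightarrow> R \<le> (\<sim>\<^sub>s)"
  by (rule predicate2I) (auto simp: saturated_bisimilar_def)

lemma saturated_bisimilar_is_bisimulation: "saturated_bisimulation (\<sim>\<^sub>s)"
  unfolding saturated_bisimulation_def
proof (intro allI impI)
  fix \<Delta> \<Theta> :: "'t dist"
  assume "\<Delta> \<sim>\<^sub>s \<Theta>"
  then obtain R where R: "saturated_bisimulation R" "R \<Delta> \<Theta>"
    unfolding saturated_bisimilar_def by blast
  then have "progress R \<Delta> \<Theta>"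
    unfolding saturated_bisimulation_def by blast
  then show "progress (\<sim>\<^sub>s) \<Delta> \<Theta>"
    using progress_mono[OF saturated_bisimilar_greatest[OF R(1)]] by (rule rev_predicate2D)
qed

end

theory Submission
  imports Defs
begin

text \<open>
  The relation \<open>R\<close> is enlarged by iterated contexts \<open>((\<cdot> \<parallel> Q\<^sub>0) \<parallel> \<dots>) \<parallel> Q\<^sub>n\<close> and then by convex
  combinations.  Reassociating parallel compositions is a transition isomorphism on well-typed
  configurations, so a transition of an iterated context is one of the single context
  \<open>\<cdot> \<parallel> (Q\<^sub>0 \<parallel> (\<dots> \<parallel> Q\<^sub>n))\<close>, to which the hypothesis on \<open>R\<close> applies; reassociating the outcome
  leads back into the enlarged relation.  Convex combinations are handled pointwise, since by
  determinism every point has a unique derivative.  That derivatives have a common type is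
  subject reduction; that their states are density operators need not be computed, because the
  components of the hull are admissible.
\<close>

section \<open>Typing and substitution\<close>

text \<open>A context adds one parallel component. An answer up to contexts may already sit inside a
  context, and the next test adds another, whereas the hypothesis on \<open>R\<close> speaks of a
  single context only. The semantics has no structural congruence to merge the two, so associativity
  must be proved as a correspondence of transitions. It depends on typing: in
  \<open>P || (Q || R)\<close> a qubit sent by \<open>R\<close> may be received by \<open>Q\<close>,
  but in \<open>(P || Q) || R\<close> that reception is blocked if \<open>P\<close> owns the qubit.
  Linear ownership excludes this situation. A second obstacle is that the answer supplied by
  \<open>R\<close> consists of contexts of unknown shape. Their shape is recovered from the support,
  since transitions cannot leave the domain of the isomorphism. Finally, the components of a convex
  combination may have different types, so a common type has to be carried along separately.\<close>

lemma names_inject [simp]: "names A = names B \<longleftrightarrow> A = B"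
  by (simp add: inj_image_eq_iff inj_on_def)

text \<open>Classical values and variables never occur in a type; therefore classical communication
  and classical substitution leave types unchanged.\<close>

lemma has_type_subset_qubit_atoms: "\<Sigma> \<turnstile> P \<Longrightarrow> \<Sigma> \<subseteq> qubit_atoms"
  by (induction rule: has_type.induct) auto

inductive_cases has_type_DiscardE: "\<Sigma> \<turnstile> Discard es"
inductive_cases has_type_TauE: "\<Sigma> \<turnstile> Tau t P"
inductive_cases has_type_SyncTauE: "\<Sigma> \<turnstile> SyncTau t t' P"
inductive_cases has_type_SuperOpE: "\<Sigma> \<turnstile> SuperOp t Es es P"
inductive_cases has_type_MeasureE: "\<Sigma> \<turnstile> Measure t Ms es y P"
inductive_cases has_type_ReceiveE [consumes 1, case_names classical quantum]: "\<Sigma> \<turnstile> Receive t c x P"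
inductive_cases has_type_SendE [consumes 1, case_names classical quantum]: "\<Sigma> \<turnstile> Send t c e P"
inductive_cases has_type_CondE: "\<Sigma> \<turnstile> Cond e P Q"
inductive_cases has_type_ChoiceE: "\<Sigma> \<turnstile> Choice P Q"
inductive_cases has_type_ParE: "\<Sigma> \<turnstile> Par P Q"
inductive_cases has_type_RestrictE: "\<Sigma> \<turnstile> Restrict P c"

lemmas has_type_elims = has_type_DiscardE has_type_TauE has_type_SyncTauE has_type_SuperOpE
  has_type_MeasureE has_type_ReceiveE has_type_SendE has_type_CondE has_type_ChoiceE
  has_type_ParE has_type_RestrictE

text \<open>Adding or removing an atom can be undone because the quantum rules record whether it was
  present: \<open>EVar x \<notin> \<Sigma>\<close> for reception, \<open>e \<in> \<Sigma>\<close>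
  for sending. Uniqueness later identifies the type chosen existentially in the side condition of
  the parallel rules.\<close>

lemma has_type_unique: "\<Sigma> \<turnstile> P \<Longrightarrow> \<Sigma>' \<turnstile> P \<Longrightarrow> \<Sigma> = \<Sigma>'"
proof (induction arbitrary: \<Sigma>' rule: has_type.induct)
  case (t_qreceive c x \<Sigma> P t)
  from t_qreceive.prems t_qreceive.hyps(1) have "EVar x \<notin> \<Sigma>'" "\<Sigma>' \<union> {EVar x} \<turnstile> P"
    by (auto elim: has_type_ReceiveE)
  with t_qreceive.IH t_qreceive.hyps(3) show ?case by blast
next
  case (t_qsend c e \<Sigma> P t)
  from t_qsend.prems t_qsend.hyps(1) have "e \<in> \<Sigma>'" "\<Sigma>' - {e} \<turnstile> P"
    by (auto elim: has_type_SendE)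
  with t_qsend.IH t_qsend.hyps(3) show ?case by blast
qed (elim has_type_elims; blast)+

lemma subst_expr_idem_atom:
  "e \<in> qubit_atoms \<Longrightarrow> e \<noteq> EVar x \<Longrightarrow> subst_expr x v e = e"
  by (cases e) (auto simp: qubit_atoms_def)

lemma EVal_qubit_atoms [simp]: "EVal v \<in> qubit_atoms \<longleftrightarrow> type_of_val v = TQubit"
  by (cases v) (auto simp: qubit_atoms_def)

lemma EVar_qubit_atoms [simp]: "EVar x \<in> qubit_atoms \<longleftrightarrow> var_type x = TQubit"
  by (auto simp: qubit_atoms_def)

lemma subst_expr_qubit_atoms:
  assumes "e \<in> qubit_atoms" "var_type x = type_of_val v"
  shows "subst_expr x v e \<in> qubit_atoms"
proof (cases "e = EVar x")
  case False
  with assms show ?thesis by (simp add: subst_expr_idem_atom)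
qed (use assms in simp)

lemma subst_expr_image_idem:
  assumes "\<Sigma> \<subseteq> qubit_atoms" "EVar x \<notin> \<Sigma>"
  shows "subst_expr x v ` \<Sigma> = \<Sigma>"
proof -
  have "subst_expr x v e = e" if "e \<in> \<Sigma>" for e
    using assms that by (auto intro: subst_expr_idem_atom)
  then show ?thesis by simp
qed

lemma subst_expr_type:
  "expr_type e T \<Longrightarrow> var_type x = type_of_val v \<Longrightarrow> expr_type (subst_expr x v e) T"
proof (induction rule: expr_type.induct)
  case (1 y)
  then show ?case using expr_type.intros(1)[of y] expr_type.intros(2)[of v] by auto
qed (auto intro: expr_type.intros)

lemma evaluates_type: "e \<Down> v \<Longrightarrow> expr_type e T \<Longrightarrow> type_of_val v = T"
  by (induction arbitrary: T rule: evaluates.induct) (auto elim: expr_type.cases)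

lemma evaluates_qubit_atom: "e \<Down> v \<Longrightarrow> e \<in> qubit_atoms \<Longrightarrow> e = EVal v"
  by (cases rule: evaluates.cases) (auto simp: qubit_atoms_def)

text \<open>Substituting a name already in \<open>\<Sigma>\<close> for a variable of
  \<open>\<Sigma>\<close> would merge two atoms, destroying the \<open>distinct\<close> lists and
  disjoint unions of the typing rules. Injectivity on \<open>\<Sigma>\<close> excludes this.\<close>

lemma subst_has_type:
  "\<Sigma> \<turnstile> P \<Longrightarrow> var_type x = type_of_val v \<Longrightarrow> inj_on (subst_expr x v) \<Sigma> \<Longrightarrow>
   subst_expr x v ` \<Sigma> \<turnstile> subst x v P"
proof (induction rule: has_type.induct)
  case (t_discard es \<Sigma>)
  then show ?case
    by (auto intro!: has_type.t_discard simp: distinct_map subst_expr_qubit_atoms subset_iff)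
next
  case (t_superop es \<Sigma> Es P t)
  then show ?case
    by (simp add: has_type.t_superop distinct_map image_mono inj_on_subset)
next
  case (t_measure es \<Sigma> Ms y P t)
  have "subst_expr x v ` \<Sigma> \<turnstile> (if y = x then P else subst x v P)"
  proof (cases "y = x")
    case True
    \<comment> \<open>A shadowing binder stops the substitution, so the image of
      \<open>\<Sigma>\<close> must be \<open>\<Sigma>\<close> itself. It is, because here
      \<open>x\<close> has type \<open>TNat\<close>.\<close>
    have "\<Sigma> \<subseteq> qubit_atoms" using t_measure.hyps(5) by (rule has_type_subset_qubit_atoms)
    moreover from this True t_measure.hyps(4) have "EVar x \<notin> \<Sigma>" by auto
    ultimately show ?thesis using True t_measure.hyps(5) by (simp add: subst_expr_image_idem)
  qed (use t_measure in simp)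
  with t_measure show ?case
    by (simp add: has_type.t_measure distinct_map image_mono inj_on_subset)
next
  case (t_receive c y \<Sigma> P t)
  have "subst_expr x v ` \<Sigma> \<turnstile> (if y = x then P else subst x v P)"
  proof (cases "y = x")
    case True
    have "\<Sigma> \<subseteq> qubit_atoms" using t_receive.hyps(3) by (rule has_type_subset_qubit_atoms)
    moreover from this True t_receive.hyps(1,2) have "EVar x \<notin> \<Sigma>" by auto
    ultimately show ?thesis using True t_receive.hyps(3) by (simp add: subst_expr_image_idem)
  qed (use t_receive in simp)
  with t_receive show ?case
    by (simp add: has_type.t_receive)
next
  case (t_qreceive c y \<Sigma> P t)
  have \<Sigma>: "\<Sigma> \<subseteq> qubit_atoms" using has_type_subset_qubit_atoms[OF t_qreceive.hyps(4)] by simp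
  show ?case
  proof (cases "y = x")
    case True
    with \<Sigma> t_qreceive.hyps have "subst_expr x v ` \<Sigma> = \<Sigma>" by (simp add: subst_expr_image_idem)
    with True t_qreceive.hyps show ?thesis by (simp add: has_type.t_qreceive)
  next
    case False
    \<comment> \<open>Substitution inserts values, never variables, so \<open>EVar y\<close> could
      only be the image of itself.\<close>
    have *: "EVar y \<notin> subst_expr x v ` \<Sigma>"
      using \<Sigma> t_qreceive.hyps(3) False by (auto simp: qubit_atoms_def split: if_splits)
    with False t_qreceive.prems have "inj_on (subst_expr x v) (\<Sigma> \<union> {EVar y})" by auto
    from t_qreceive.IH[OF t_qreceive.prems(1) this] False
    have "subst_expr x v ` \<Sigma> \<union> {EVar y} \<turnstile> subst x v P" by simp
    with * False t_qreceive.hyps show ?thesis by (simp add: has_type.t_qreceive)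
  qed
next
  case (t_send c e \<Sigma> P t)
  then show ?case by (simp add: has_type.t_send subst_expr_type)
next
  case (t_qsend c e \<Sigma> P t)
  have "subst_expr x v ` (\<Sigma> - {e}) = subst_expr x v ` \<Sigma> - {subst_expr x v e}"
    using t_qsend.prems(2) t_qsend.hyps(3) by (auto simp: inj_on_def)
  moreover have "subst_expr x v ` (\<Sigma> - {e}) \<turnstile> subst x v P"
    using t_qsend by (intro t_qsend.IH) (auto intro: inj_on_subset)
  ultimately show ?case
    using t_qsend by (simp add: has_type.t_qsend subst_expr_qubit_atoms)
next
  case (t_par \<Sigma>\<^sub>1 P \<Sigma>\<^sub>2 Q)
  then have "subst_expr x v ` \<Sigma>\<^sub>1 \<inter> subst_expr x v ` \<Sigma>\<^sub>2 = {}"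
    by (auto simp: inj_on_def)
  with t_par show ?case
    by (auto simp: image_Un intro!: has_type.t_par intro: inj_on_subset)
qed (auto intro: has_type.intros subst_expr_type)


section \<open>Subject reduction\<close>

text \<open>Ownership after an action. Intersecting with \<open>qubit_atoms\<close> makes the
  reception of a classical value neutral; removal on sending affects only qubits, because types
  contain no classical values.\<close>

fun residual_type :: "act \<Rightarrow> expr set \<Rightarrow> expr set" where
  "residual_type ATau \<Sigma> = \<Sigma>"
| "residual_type (ASend c v) \<Sigma> = \<Sigma> - {EVal v}"
| "residual_type (ARecv c v) \<Sigma> = \<Sigma> \<union> ({EVal v} \<inter> qubit_atoms)"

lemma step_state_space:
  "step C \<mu> s \<Delta> \<Longrightarrow> C = Conf S \<rho> P \<Longrightarrow> C' \<in> set_pmf \<Delta> \<Longrightarrow> \<exists>\<rho>' P'. C' = Conf S \<rho>' P'"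
  by (induction arbitrary: S \<rho> P C' rule: step.induct) fastforce+

text \<open>Linearity: the quantum send rule demands ownership, and the type of a whole process
  contains the type of its moving component.\<close>

lemma step_send_qubit:
  "step C \<mu> s \<Delta> \<Longrightarrow> C = Conf S \<rho> P \<Longrightarrow> \<mu> = ASend c v \<Longrightarrow> \<Sigma> \<turnstile> P \<Longrightarrow> type_of_val v = TQubit \<Longrightarrow>
   EVal v \<in> \<Sigma>"
proof (induction arbitrary: S \<rho> P c v \<Sigma> rule: step.induct)
  case (s_send e v t c P)
  from s_send.prems s_send.hyps show ?case
    by (auto elim!: has_type_SendE dest: evaluates_type evaluates_qubit_atom)
qed (fastforce elim: has_type_elims)+

text \<open>An emitted qubit is owned on the side of \<open>\<Sigma>\<close>. This discharges the
  side condition on reception when the receiver sits beside \<open>Q\<close>.\<close>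

lemma send_fresh:
  assumes "step (Conf S \<rho> P) (ASend c v) s \<Delta>" "\<Sigma> \<turnstile> P" "\<Sigma>' \<turnstile> Q" "\<Sigma> \<inter> \<Sigma>' = {}"
  shows "EVal v \<notin> \<Sigma>'"
proof
  assume v: "EVal v \<in> \<Sigma>'"
  with has_type_subset_qubit_atoms[OF assms(3)] have "type_of_val v = TQubit" by auto
  from step_send_qubit[OF assms(1) refl refl assms(2) this] v assms(4) show False by blast
qed

lemma Conf_eq_restrict_conf:
  "Conf S \<rho> P = restrict_conf c C \<longleftrightarrow> (\<exists>P'. P = Restrict P' c \<and> C = Conf S \<rho> P')"
  by (cases C) auto

lemma Conf_eq_par_right: "Conf S \<rho> P = par_right Q C \<longleftrightarrow> (\<exists>P'. P = Par P' Q \<and> C = Conf S \<rho> P')"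
  by (cases C) auto

lemma Conf_eq_par_left: "Conf S \<rho> P = par_left Q C \<longleftrightarrow> (\<exists>P'. P = Par Q P' \<and> C = Conf S \<rho> P')"
  by (cases C) auto

text \<open>Stated for every action, since a communication combines a send derivative with a receive
  derivative. The freshness premise is vacuous for other actions, and within a communication it
  follows from ownership by the sender.\<close>

lemma subject_reduction:
  "step C \<mu> s \<Delta> \<Longrightarrow> C = Conf S \<rho> P \<Longrightarrow> \<Sigma> \<turnstile> P \<Longrightarrow> (\<forall>c v. \<mu> = ARecv c v \<longrightarrow> EVal v \<notin> \<Sigma>) \<Longrightarrow>
   Conf S' \<rho>' P' \<in> set_pmf \<Delta> \<Longrightarrow> residual_type \<mu> \<Sigma> \<turnstile> P'"
proof (induction arbitrary: S \<rho> P \<Sigma> S' \<rho>' P' rule: step.induct)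
  case (s_send e v S0 \<rho>0 t c P0)
  have [simp]: "P = Send t c e P0" "P' = P0" using s_send.prems by auto
  from s_send.prems(2)[simplified] show ?case
  proof (cases rule: has_type_SendE)
    case classical
    with evaluates_type[OF s_send.hyps classical(2)] have "type_of_val v \<noteq> TQubit" by simp
    then have "EVal v \<notin> \<Sigma>" using has_type_subset_qubit_atoms[OF classical(3)] by auto
    with classical show ?thesis by simp
  next
    case quantum
    with s_send.hyps show ?thesis by (auto dest: evaluates_qubit_atom)
  qed
next
  case (s_receive v c S0 \<rho>0 t x P0)
  have [simp]: "P = Receive t c x P0" "P' = subst x v P0" using s_receive.prems by auto
  have fresh: "EVal v \<notin> \<Sigma>" using s_receive.prems by simp
  from s_receive.prems(2)[simplified] show ?case
  proof (cases rule: has_type_ReceiveE)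
    case classical
    have \<Sigma>: "\<Sigma> \<subseteq> qubit_atoms" using has_type_subset_qubit_atoms[OF classical(3)] .
    moreover have "EVar x \<notin> \<Sigma>" using classical \<Sigma> by auto
    ultimately have "subst_expr x v ` \<Sigma> = \<Sigma>" "inj_on (subst_expr x v) \<Sigma>"
      by (simp_all add: subst_expr_image_idem inj_on_def)
        (metis subst_expr_idem_atom subset_iff)
    with subst_has_type[OF classical(3), of x v] classical s_receive.hyps show ?thesis by simp
  next
    case quantum
    have \<Sigma>: "\<Sigma> \<subseteq> qubit_atoms" using has_type_subset_qubit_atoms[OF quantum(4)] by simp
    then have im: "subst_expr x v ` \<Sigma> = \<Sigma>" and id: "inj_on (subst_expr x v) \<Sigma>"
      using quantum by (simp_all add: subst_expr_image_idem inj_on_def)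
        (metis subst_expr_idem_atom subset_iff)
    \<comment> \<open>The new image point is \<open>EVal v\<close>; freshness keeps it apart from
      \<open>\<Sigma>\<close>, the image of the rest.\<close>
    then have "inj_on (subst_expr x v) (insert (EVar x) \<Sigma>)" using fresh by auto
    from subst_has_type[OF quantum(4) _ this] quantum s_receive.hyps im show ?thesis by simp
  qed
next
  case (s_measure J Ms S0 qs \<rho>0 t y P0)
  from s_measure.prems(2)[folded conf.inject] s_measure.prems(1)
  have ty: "var_type y = TNat" "\<Sigma> \<turnstile> P0"
    by (auto elim: has_type_MeasureE)
  have \<Sigma>: "\<Sigma> \<subseteq> qubit_atoms" using has_type_subset_qubit_atoms[OF ty(2)] .
  then have "EVar y \<notin> \<Sigma>" using ty(1) by auto
  with \<Sigma> have im: "subst_expr y (VNat m) ` \<Sigma> = \<Sigma>" and id: "inj_on (subst_expr y (VNat m)) \<Sigma>" for m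
    by (simp_all add: subst_expr_image_idem inj_on_def)
      (metis subst_expr_idem_atom subset_iff)
  have "\<Sigma> \<turnstile> subst y (VNat m) P0" for m
    using subst_has_type[OF ty(2) _ id] ty(1) im by simp
  with s_measure.prems(4) show ?case by auto
next
  case (s_restrict S0 \<rho>0 P0 \<mu> s \<Delta> c)
  from s_restrict.prems obtain P1 where P1: "P' = Restrict P1 c" "Conf S' \<rho>' P1 \<in> set_pmf \<Delta>"
    by (auto simp: Conf_eq_restrict_conf)
  with s_restrict show ?case
    by (auto elim!: has_type_RestrictE intro!: has_type.t_restrict)
next
  case (s_par_left S0 \<rho>0 P0 \<mu> s \<Delta> \<Sigma>' Q)
  from s_par_left.prems obtain P1 where P1: "P' = Par P1 Q" "Conf S' \<rho>' P1 \<in> set_pmf \<Delta>"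
    by (auto simp: Conf_eq_par_right)
  from s_par_left.prems(1,2) obtain \<Sigma>1 \<Sigma>2 where
    \<Sigma>: "\<Sigma> = \<Sigma>1 \<union> \<Sigma>2" "\<Sigma>1 \<turnstile> P0" "\<Sigma>2 \<turnstile> Q" "\<Sigma>1 \<inter> \<Sigma>2 = {}"
    by (auto elim!: has_type_ParE simp: Int_commute)
  have IH: "residual_type \<mu> \<Sigma>1 \<turnstile> P1"
    using s_par_left.prems(3) \<Sigma> P1 by (intro s_par_left.IH) auto
  \<comment> \<open>For a send, the idle component does not own the atom removed; for a receive,
    disjointness is the freshness premise.\<close>
  have "residual_type \<mu> \<Sigma>1 \<union> \<Sigma>2 = residual_type \<mu> \<Sigma>" "residual_type \<mu> \<Sigma>1 \<inter> \<Sigma>2 = {}"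
    using s_par_left.prems(3) \<Sigma> send_fresh[OF _ \<Sigma>(2,3,4)] s_par_left.hyps(1)
    by (cases \<mu>; auto)+
  with has_type.t_par[OF IH \<Sigma>(3)] P1 show ?case by simp
next
  case (s_par_right S0 \<rho>0 P0 \<mu> s \<Delta> \<Sigma>' Q)
  from s_par_right.prems obtain P1 where P1: "P' = Par Q P1" "Conf S' \<rho>' P1 \<in> set_pmf \<Delta>"
    by (auto simp: Conf_eq_par_left)
  from s_par_right.prems(1,2) obtain \<Sigma>1 \<Sigma>2 where
    \<Sigma>: "\<Sigma> = \<Sigma>2 \<union> \<Sigma>1" "\<Sigma>1 \<turnstile> P0" "\<Sigma>2 \<turnstile> Q" "\<Sigma>1 \<inter> \<Sigma>2 = {}"
    by (auto elim!: has_type_ParE simp: Int_commute)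
  have IH: "residual_type \<mu> \<Sigma>1 \<turnstile> P1"
    using s_par_right.prems(3) \<Sigma> P1 by (intro s_par_right.IH) auto
  have "\<Sigma>2 \<union> residual_type \<mu> \<Sigma>1 = residual_type \<mu> \<Sigma>" "\<Sigma>2 \<inter> residual_type \<mu> \<Sigma>1 = {}"
    using s_par_right.prems(3) \<Sigma> send_fresh[OF _ \<Sigma>(2,3,4)] s_par_right.hyps(1)
    by (cases \<mu>; auto)+
  with has_type.t_par[OF \<Sigma>(3) IH] P1 show ?case by simp
next
  case (s_comm_left S0 \<rho>0 P0 c v t P1 Q0 t' Q1)
  from s_comm_left.prems(1,2) obtain \<Sigma>1 \<Sigma>2 where
    \<Sigma>: "\<Sigma> = \<Sigma>1 \<union> \<Sigma>2" "\<Sigma>1 \<turnstile> P0" "\<Sigma>2 \<turnstile> Q0" "\<Sigma>1 \<inter> \<Sigma>2 = {}"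
    by (auto elim!: has_type_ParE simp: Int_commute)
  have v: "EVal v \<notin> \<Sigma>2" using send_fresh[OF s_comm_left.hyps(1) \<Sigma>(2,3,4)] .
  have q: "type_of_val v = TQubit \<Longrightarrow> EVal v \<in> \<Sigma>1"
    using step_send_qubit[OF s_comm_left.hyps(1) refl refl \<Sigma>(2)] .
  have sub: "\<Sigma>1 \<subseteq> qubit_atoms" using has_type_subset_qubit_atoms[OF \<Sigma>(2)] .
  have 1: "\<Sigma>1 - {EVal v} \<turnstile> P1"
    using s_comm_left.IH(1)[OF refl \<Sigma>(2)] by simp
  have 2: "\<Sigma>2 \<union> ({EVal v} \<inter> qubit_atoms) \<turnstile> Q1"
    using s_comm_left.IH(2)[OF refl \<Sigma>(3)] v by simp
  \<comment> \<open>A qubit moves from \<open>\<Sigma>1\<close> to \<open>\<Sigma>2\<close>, a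
    classical value changes neither; in both cases the union remains
    \<open>\<Sigma>\<close>.\<close>
  have "(\<Sigma>1 - {EVal v}) \<union> (\<Sigma>2 \<union> ({EVal v} \<inter> qubit_atoms)) = \<Sigma>"
    "(\<Sigma>1 - {EVal v}) \<inter> (\<Sigma>2 \<union> ({EVal v} \<inter> qubit_atoms)) = {}"
    using \<Sigma>(1,4) v q sub by auto
  with has_type.t_par[OF 1 2] s_comm_left.prems show ?case by simp
next
  case (s_comm_right S0 \<rho>0 P0 c v t P1 Q0 t' Q1)
  from s_comm_right.prems(1,2) obtain \<Sigma>1 \<Sigma>2 where
    \<Sigma>: "\<Sigma> = \<Sigma>2 \<union> \<Sigma>1" "\<Sigma>1 \<turnstile> P0" "\<Sigma>2 \<turnstile> Q0" "\<Sigma>1 \<inter> \<Sigma>2 = {}"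
    by (auto elim!: has_type_ParE simp: Int_commute)
  have v: "EVal v \<notin> \<Sigma>2" using send_fresh[OF s_comm_right.hyps(1) \<Sigma>(2,3,4)] .
  have q: "type_of_val v = TQubit \<Longrightarrow> EVal v \<in> \<Sigma>1"
    using step_send_qubit[OF s_comm_right.hyps(1) refl refl \<Sigma>(2)] .
  have sub: "\<Sigma>1 \<subseteq> qubit_atoms" using has_type_subset_qubit_atoms[OF \<Sigma>(2)] .
  have 1: "\<Sigma>1 - {EVal v} \<turnstile> P1"
    using s_comm_right.IH(1)[OF refl \<Sigma>(2)] by simp
  have 2: "\<Sigma>2 \<union> ({EVal v} \<inter> qubit_atoms) \<turnstile> Q1"
    using s_comm_right.IH(2)[OF refl \<Sigma>(3)] v by simp
  have "(\<Sigma>2 \<union> ({EVal v} \<inter> qubit_atoms)) \<union> (\<Sigma>1 - {EVal v}) = \<Sigma>"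
    "(\<Sigma>2 \<union> ({EVal v} \<inter> qubit_atoms)) \<inter> (\<Sigma>1 - {EVal v}) = {}"
    using \<Sigma>(1,4) v q sub by auto
  with has_type.t_par[OF 2 1] s_comm_right.prems show ?case by simp
qed (fastforce elim: has_type_elims)+


section \<open>Associativity of parallel composition\<close>

text \<open>The identity outside \<open>nested_par\<close>, and therefore not injective as a whole:
  a left-nested composition whose last component is not parallel is fixed, but it is also the image
  of its right-nested form. Injectivity is claimed on \<open>nested_par\<close> only.\<close>

fun reassoc :: "'t conf \<Rightarrow> 't conf" where
  "reassoc (Conf S \<rho> (Par P (Par Q R))) = Conf S \<rho> (Par (Par P Q) R)"
| "reassoc C = C"

definition nested_par :: "'t conf set" where
  "nested_par = {Conf S \<rho> (Par P (Par Q R)) | S \<rho> P Q R. True}"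

lemma nested_parI [simp]: "Conf S \<rho> (Par P (Par Q R)) \<in> nested_par"
  by (auto simp: nested_par_def)

lemma par_right_Par_in_nested_par [simp]: "par_right (Par Q R) C \<in> nested_par"
  by (cases C) simp

lemma par_left_par_in_nested_par [simp]:
  "par_left P (par_right R C) \<in> nested_par" "par_left P (par_left Q C) \<in> nested_par"
  by (cases C; simp)+

lemma reassoc_par [simp]:
  "reassoc (par_right (Par Q R) C) = par_right R (par_right Q C)"
  "reassoc (par_left P (par_right R C)) = par_right R (par_left P C)"
  "reassoc (par_left P (par_left Q C)) = par_left (Par P Q) C"
  by (cases C; simp)+

text \<open>All points of the support have one image and \<open>par_right Q\<close> is injective, so
  the source is a point too. This takes apart a communication whose partner is a nested
  component.\<close>

lemma return_pmf_eq_map_par_right: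
  assumes "return_pmf (Conf S \<rho> X) = map_pmf (par_right Q) \<Delta>"
  obtains P where "X = Par P Q" "\<Delta> = return_pmf (Conf S \<rho> P)"
proof -
  have *: "Conf S \<rho> X = par_right Q C" if "C \<in> set_pmf \<Delta>" for C
  proof -
    from that have "par_right Q C \<in> set_pmf (map_pmf (par_right Q) \<Delta>)" by simp
    then show ?thesis unfolding assms[symmetric] by simp
  qed
  obtain C where "C \<in> set_pmf \<Delta>" using set_pmf_not_empty[of \<Delta>] by blast
  with * obtain P where P: "X = Par P Q" by (auto simp: Conf_eq_par_right)
  with * have "set_pmf \<Delta> \<subseteq> {Conf S \<rho> P}" by (auto simp: Conf_eq_par_right)
  with P that show thesis by (simp add: set_pmf_subset_singleton)
qed

lemma return_pmf_eq_map_par_left: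
  assumes "return_pmf (Conf S \<rho> X) = map_pmf (par_left Q) \<Delta>"
  obtains P where "X = Par Q P" "\<Delta> = return_pmf (Conf S \<rho> P)"
proof -
  have *: "Conf S \<rho> X = par_left Q C" if "C \<in> set_pmf \<Delta>" for C
  proof -
    from that have "par_left Q C \<in> set_pmf (map_pmf (par_left Q) \<Delta>)" by simp
    then show ?thesis unfolding assms[symmetric] by simp
  qed
  obtain C where "C \<in> set_pmf \<Delta>" using set_pmf_not_empty[of \<Delta>] by blast
  with * obtain P where P: "X = Par Q P" by (auto simp: Conf_eq_par_left)
  with * have "set_pmf \<Delta> \<subseteq> {Conf S \<rho> P}" by (auto simp: Conf_eq_par_left)
  with P that show thesis by (simp add: set_pmf_subset_singleton)
qed

inductive_cases step_ParE [consumes 1, case_names left right comm_left comm_right]: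
  "step (Conf S \<rho> (Par P Q)) \<mu> s \<Delta>"

lemma has_type_Par_assoc: "\<Sigma> \<turnstile> Par (Par P Q) R \<longleftrightarrow> \<Sigma> \<turnstile> Par P (Par Q R)"
proof
  assume "\<Sigma> \<turnstile> Par (Par P Q) R"
  then obtain \<Sigma>1 \<Sigma>2 \<Sigma>3 where "\<Sigma> = (\<Sigma>1 \<union> \<Sigma>2) \<union> \<Sigma>3" "\<Sigma>1 \<turnstile> P" "\<Sigma>2 \<turnstile> Q" "\<Sigma>3 \<turnstile> R"
      "\<Sigma>1 \<inter> \<Sigma>2 = {}" "(\<Sigma>1 \<union> \<Sigma>2) \<inter> \<Sigma>3 = {}"
    by (auto elim!: has_type_ParE)
  then have "\<Sigma>1 \<union> (\<Sigma>2 \<union> \<Sigma>3) \<turnstile> Par P (Par Q R)"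
    by (intro t_par) auto
  with \<open>\<Sigma> = _\<close> show "\<Sigma> \<turnstile> Par P (Par Q R)" by (simp add: Un_assoc)
next
  assume "\<Sigma> \<turnstile> Par P (Par Q R)"
  then obtain \<Sigma>1 \<Sigma>2 \<Sigma>3 where "\<Sigma> = \<Sigma>1 \<union> (\<Sigma>2 \<union> \<Sigma>3)" "\<Sigma>1 \<turnstile> P" "\<Sigma>2 \<turnstile> Q" "\<Sigma>3 \<turnstile> R"
      "\<Sigma>2 \<inter> \<Sigma>3 = {}" "\<Sigma>1 \<inter> (\<Sigma>2 \<union> \<Sigma>3) = {}"
    by (auto elim!: has_type_ParE)
  then have "(\<Sigma>1 \<union> \<Sigma>2) \<union> \<Sigma>3 \<turnstile> Par (Par P Q) R"
    by (intro t_par) auto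
  with \<open>\<Sigma> = _\<close> show "\<Sigma> \<turnstile> Par (Par P Q) R" by (simp add: Un_assoc)
qed

context
  fixes \<Sigma>1 \<Sigma>2 \<Sigma>3 :: "expr set" and P Q R :: "'t proc"
  assumes ty: "\<Sigma>1 \<turnstile> P" "\<Sigma>2 \<turnstile> Q" "\<Sigma>3 \<turnstile> R"
    and disj: "\<Sigma>1 \<inter> \<Sigma>2 = {}" "\<Sigma>1 \<inter> \<Sigma>3 = {}" "\<Sigma>2 \<inter> \<Sigma>3 = {}"
begin

lemma type_PQ: "\<Sigma>1 \<union> \<Sigma>2 \<turnstile> Par P Q" and type_QR: "\<Sigma>2 \<union> \<Sigma>3 \<turnstile> Par Q R"
  using ty disj by (auto intro!: t_par)

text \<open>Either one of the three components moves or two of them communicate; each case is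
  rebuilt in the other bracketing. A receiver may acquire a new neighbour, and typing ensures that
  this neighbour does not own the value.\<close>

lemma step_reassoc_aux:
  assumes "step (Conf S \<rho> (Par P (Par Q R))) \<mu> s \<Delta>"
  shows "set_pmf \<Delta> \<subseteq> nested_par \<and> step (Conf S \<rho> (Par (Par P Q) R)) \<mu> s (map_pmf reassoc \<Delta>)"
  using assms
proof (cases rule: step_ParE)
  case (left \<Delta>0 \<Sigma>')
  \<comment> \<open>The rule says only that some type of \<open>Par Q R\<close> avoids the received
    value; unique typing turns this into a statement about both \<open>\<Sigma>2\<close> and
    \<open>\<Sigma>3\<close>.\<close>
  have "\<Sigma>' = \<Sigma>2 \<union> \<Sigma>3" using has_type_unique left(3) type_QR by blast
  with left have fr: "\<forall>c v. \<mu> = ARecv c v \<longrightarrow> EVal v \<notin> \<Sigma>2"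
      "\<forall>c v. \<mu> = ARecv c v \<longrightarrow> EVal v \<notin> \<Sigma>3" by auto
  from s_par_left[OF s_par_left[OF left(2) ty(2) fr(1)] ty(3) fr(2)] left(1)
  show ?thesis by (auto simp: map_pmf_comp)
next
  case (right \<Delta>0 \<Sigma>')
  have "\<Sigma>' = \<Sigma>1" using has_type_unique right(3) ty(1) by blast
  with right have fr1: "\<forall>c v. \<mu> = ARecv c v \<longrightarrow> EVal v \<notin> \<Sigma>1" by simp
  from right(2) show ?thesis
  proof (cases rule: step_ParE)
    case (left \<Delta>1 \<Sigma>'')
    have "\<Sigma>'' = \<Sigma>3" using has_type_unique left(3) ty(3) by blast
    with left have fr: "\<forall>c v. \<mu> = ARecv c v \<longrightarrow> EVal v \<notin> \<Sigma>3" by simp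
    from s_par_left[OF s_par_right[OF left(2) ty(1) fr1] ty(3) fr] left(1) right(1)
    show ?thesis by (auto simp: map_pmf_comp)
  next
    case r: (right \<Delta>1 \<Sigma>'')
    have "\<Sigma>'' = \<Sigma>2" using has_type_unique r(3) ty(2) by blast
    with r fr1 have fr: "\<forall>c v. \<mu> = ARecv c v \<longrightarrow> EVal v \<notin> \<Sigma>1 \<union> \<Sigma>2" by simp
    from s_par_right[OF r(2) type_PQ fr] r(1) right(1)
    show ?thesis by (auto simp: map_pmf_comp)
  next
    case (comm_left c v t Q' t' R')
    from s_par_right[OF comm_left(4) ty(1)]
    have "step (Conf S \<rho> (Par P Q)) (ASend c v) (One t) (return_pmf (Conf S \<rho> (Par P Q')))" by simp
    from s_comm_left[OF this comm_left(5)] comm_left(1-3) right(1) show ?thesis by simp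
  next
    case (comm_right c v t R' t' Q')
    \<comment> \<open>\<open>Q\<close> now receives beside \<open>P\<close>; the value comes from
      \<open>R\<close>, so \<open>P\<close> does not own it.\<close>
    have "EVal v \<notin> \<Sigma>1" using send_fresh[OF comm_right(4) ty(3,1)] disj by blast
    with s_par_right[OF comm_right(5) ty(1)]
    have "step (Conf S \<rho> (Par P Q)) (ARecv c v) (One t') (return_pmf (Conf S \<rho> (Par P Q')))" by simp
    from s_comm_right[OF comm_right(4) this] comm_right(1-3) right(1) show ?thesis by simp
  qed
next
  case (comm_left c v t P' t' X)
  from comm_left(5) show ?thesis
  proof (cases rule: step_ParE)
    case (left \<Delta>1 \<Sigma>'')
    from return_pmf_eq_map_par_right[OF left(1)]
    obtain Q' where X: "X = Par Q' R" "\<Delta>1 = return_pmf (Conf S \<rho> Q')" .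
    from s_par_left[OF s_comm_left[OF comm_left(4) left(2)[unfolded X]] ty(3)] comm_left(1-3) X
    show ?thesis by simp
  next
    case (right \<Delta>1 \<Sigma>'')
    from return_pmf_eq_map_par_left[OF right(1)]
    obtain R' where X: "X = Par Q R'" "\<Delta>1 = return_pmf (Conf S \<rho> R')" .
    from s_par_left[OF comm_left(4) ty(2)]
    have "step (Conf S \<rho> (Par P Q)) (ASend c v) (One t) (return_pmf (Conf S \<rho> (Par P' Q)))" by simp
    from s_comm_left[OF this right(2)[unfolded X]] comm_left(1-3) X show ?thesis by simp
  qed auto
next
  case (comm_right c v t X t' P')
  from comm_right(4) show ?thesis
  proof (cases rule: step_ParE)
    case (left \<Delta>1 \<Sigma>'')
    from return_pmf_eq_map_par_right[OF left(1)]
    obtain Q' where X: "X = Par Q' R" "\<Delta>1 = return_pmf (Conf S \<rho> Q')" .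
    from s_par_left[OF s_comm_right[OF left(2)[unfolded X] comm_right(5)] ty(3)] comm_right(1-3) X
    show ?thesis by simp
  next
    case (right \<Delta>1 \<Sigma>'')
    from return_pmf_eq_map_par_left[OF right(1)]
    obtain R' where X: "X = Par Q R'" "\<Delta>1 = return_pmf (Conf S \<rho> R')" .
    have "EVal v \<notin> \<Sigma>2" using send_fresh[OF right(2) ty(3,2)] disj by blast
    with s_par_left[OF comm_right(5) ty(2)]
    have "step (Conf S \<rho> (Par P Q)) (ARecv c v) (One t') (return_pmf (Conf S \<rho> (Par P' Q)))" by simp
    from s_comm_right[OF right(2)[unfolded X] this] comm_right(1-3) X show ?thesis by simp
  qed auto
qed

lemma step_unreassoc_aux:
  assumes "step (Conf S \<rho> (Par (Par P Q) R)) \<mu> s \<Delta>'"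
  shows "\<exists>\<Delta>. step (Conf S \<rho> (Par P (Par Q R))) \<mu> s \<Delta> \<and> \<Delta>' = map_pmf reassoc \<Delta>"
  using assms
proof (cases rule: step_ParE)
  case l: (left \<Delta>0 \<Sigma>')
  have "\<Sigma>' = \<Sigma>3" using has_type_unique l(3) ty(3) by blast
  with l have fr3: "\<forall>c v. \<mu> = ARecv c v \<longrightarrow> EVal v \<notin> \<Sigma>3" by simp
  from l(2) show ?thesis
  proof (cases rule: step_ParE)
    case (left \<Delta>1 \<Sigma>'')
    have "\<Sigma>'' = \<Sigma>2" using has_type_unique left(3) ty(2) by blast
    with left fr3 have fr: "\<forall>c v. \<mu> = ARecv c v \<longrightarrow> EVal v \<notin> \<Sigma>2 \<union> \<Sigma>3" by simp
    from s_par_left[OF left(2) type_QR fr] left(1) l(1)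
    show ?thesis by (auto simp: map_pmf_comp intro!: exI)
  next
    case r: (right \<Delta>1 \<Sigma>'')
    have "\<Sigma>'' = \<Sigma>1" using has_type_unique r(3) ty(1) by blast
    with r have fr1: "\<forall>c v. \<mu> = ARecv c v \<longrightarrow> EVal v \<notin> \<Sigma>1" by simp
    from s_par_right[OF s_par_left[OF r(2) ty(3) fr3] ty(1) fr1] r(1) l(1)
    show ?thesis by (auto simp: map_pmf_comp intro!: exI)
  next
    case (comm_left c v t P' t' Q')
    \<comment> \<open>Regrouping puts the receiver \<open>Q\<close> beside \<open>R\<close>, which
      does not own what \<open>P\<close> sends.\<close>
    have "EVal v \<notin> \<Sigma>3" using send_fresh[OF comm_left(4) ty(1,3)] disj by blast
    with s_par_left[OF comm_left(5) ty(3)]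
    have "step (Conf S \<rho> (Par Q R)) (ARecv c v) (One t') (return_pmf (Conf S \<rho> (Par Q' R)))" by simp
    from s_comm_left[OF comm_left(4) this] comm_left(1-3) l(1) show ?thesis by (auto intro!: exI)
  next
    case (comm_right c v t Q' t' P')
    from s_par_left[OF comm_right(4) ty(3)]
    have "step (Conf S \<rho> (Par Q R)) (ASend c v) (One t) (return_pmf (Conf S \<rho> (Par Q' R)))" by simp
    from s_comm_right[OF this comm_right(5)] comm_right(1-3) l(1) show ?thesis by (auto intro!: exI)
  qed
next
  case (right \<Delta>0 \<Sigma>')
  have "\<Sigma>' = \<Sigma>1 \<union> \<Sigma>2" using has_type_unique right(3) type_PQ by blast
  with right have fr: "\<forall>c v. \<mu> = ARecv c v \<longrightarrow> EVal v \<notin> \<Sigma>1"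
      "\<forall>c v. \<mu> = ARecv c v \<longrightarrow> EVal v \<notin> \<Sigma>2" by auto
  from s_par_right[OF s_par_right[OF right(2) ty(2) fr(2)] ty(1) fr(1)] right(1)
  show ?thesis by (auto simp: map_pmf_comp intro!: exI)
next
  case (comm_left c v t X t' R')
  from comm_left(4) show ?thesis
  proof (cases rule: step_ParE)
    case (left \<Delta>1 \<Sigma>'')
    from return_pmf_eq_map_par_right[OF left(1)]
    obtain P' where X: "X = Par P' Q" "\<Delta>1 = return_pmf (Conf S \<rho> P')" .
    have "EVal v \<notin> \<Sigma>2" using send_fresh[OF left(2) ty(1,2)] disj by blast
    with s_par_right[OF comm_left(5) ty(2)]
    have "step (Conf S \<rho> (Par Q R)) (ARecv c v) (One t') (return_pmf (Conf S \<rho> (Par Q R')))" by simp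
    from s_comm_left[OF left(2)[unfolded X] this] comm_left(1-3) X show ?thesis by (auto intro!: exI)
  next
    case (right \<Delta>1 \<Sigma>'')
    from return_pmf_eq_map_par_left[OF right(1)]
    obtain Q' where X: "X = Par P Q'" "\<Delta>1 = return_pmf (Conf S \<rho> Q')" .
    from s_par_right[OF s_comm_left[OF right(2)[unfolded X] comm_left(5)] ty(1)] comm_left(1-3) X
    show ?thesis by (auto intro!: exI)
  qed auto
next
  case (comm_right c v t R' t' X)
  from comm_right(5) show ?thesis
  proof (cases rule: step_ParE)
    case (left \<Delta>1 \<Sigma>'')
    from return_pmf_eq_map_par_right[OF left(1)]
    obtain P' where X: "X = Par P' Q" "\<Delta>1 = return_pmf (Conf S \<rho> P')" .
    from s_par_right[OF comm_right(4) ty(2)]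
    have "step (Conf S \<rho> (Par Q R)) (ASend c v) (One t) (return_pmf (Conf S \<rho> (Par Q R')))" by simp
    from s_comm_right[OF this left(2)[unfolded X]] comm_right(1-3) X show ?thesis by (auto intro!: exI)
  next
    case (right \<Delta>1 \<Sigma>'')
    from return_pmf_eq_map_par_left[OF right(1)]
    obtain Q' where X: "X = Par P Q'" "\<Delta>1 = return_pmf (Conf S \<rho> Q')" .
    from s_par_right[OF s_comm_right[OF comm_right(4) right(2)[unfolded X]] ty(1)] comm_right(1-3) X
    show ?thesis by (auto intro!: exI)
  qed auto
qed

end

lemma has_type_Par_ParE:
  assumes "\<Sigma> \<turnstile> Par P (Par Q R)"
  obtains \<Sigma>1 \<Sigma>2 \<Sigma>3 where "\<Sigma>1 \<turnstile> P" "\<Sigma>2 \<turnstile> Q" "\<Sigma>3 \<turnstile> R"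
    "\<Sigma>1 \<inter> \<Sigma>2 = {}" "\<Sigma>1 \<inter> \<Sigma>3 = {}" "\<Sigma>2 \<inter> \<Sigma>3 = {}"
  using assms by (elim has_type_ParE) (simp add: Int_Un_distrib)

lemma step_reassoc:
  assumes "\<Sigma> \<turnstile> Par P (Par Q R)" "step (Conf S \<rho> (Par P (Par Q R))) \<mu> s \<Delta>"
  shows "set_pmf \<Delta> \<subseteq> nested_par" "step (Conf S \<rho> (Par (Par P Q) R)) \<mu> s (map_pmf reassoc \<Delta>)"
  using has_type_Par_ParE[OF assms(1)] step_reassoc_aux[OF _ _ _ _ _ _ assms(2)] by metis+

lemma step_unreassoc:
  assumes "\<Sigma> \<turnstile> Par P (Par Q R)" "step (Conf S \<rho> (Par (Par P Q) R)) \<mu> s \<Delta>'"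
  shows "\<exists>\<Delta>. step (Conf S \<rho> (Par P (Par Q R))) \<mu> s \<Delta> \<and> \<Delta>' = map_pmf reassoc \<Delta>"
  using has_type_Par_ParE[OF assms(1)] step_unreassoc_aux[OF _ _ _ _ _ _ assms(2)] by metis


section \<open>Transition isomorphisms\<close>

lemma Some_in_map_option_image: "Some y \<in> map_option f ` A \<longleftrightarrow> (\<exists>x. Some x \<in> A \<and> y = f x)"
  by (auto simp: image_iff map_option_case split: option.splits)

text \<open>An isomorphism of transition systems on the well-typed part of \<open>D\<close>,
  abstracted so that the lifting to distributions is done once and isomorphisms can be composed.
  \<open>step_closed\<close> puts targets in \<open>D\<close> without typing them, so typing is
  demanded anew at every source; hence the two domains below.\<close>

locale step_iso =
  fixes D :: "'t conf set" and f :: "'t conf \<Rightarrow> 't conf"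
  assumes inj: "inj_on f D"
    and typed_iff: "C \<in> D \<Longrightarrow> conf_typed \<Sigma> \<Sigma>' (f C) \<longleftrightarrow> conf_typed \<Sigma> \<Sigma>' C"
    and step_closed: "C \<in> D \<Longrightarrow> conf_typed \<Sigma> \<Sigma>' C \<Longrightarrow> step C \<mu> s \<Delta> \<Longrightarrow> set_pmf \<Delta> \<subseteq> D"
    and step_map: "C \<in> D \<Longrightarrow> conf_typed \<Sigma> \<Sigma>' C \<Longrightarrow> step C \<mu> s \<Delta> \<Longrightarrow> step (f C) \<mu> s (map_pmf f \<Delta>)"
    and step_map_inv: "C \<in> D \<Longrightarrow> conf_typed \<Sigma> \<Sigma>' C \<Longrightarrow> step (f C) \<mu> s \<Delta>' \<Longrightarrow>
      \<exists>\<Delta>. step C \<mu> s \<Delta> \<and> \<Delta>' = map_pmf f \<Delta>"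
begin

section \<open>Lifting an isomorphism to distributions, reachability and admissibility\<close>

definition dom :: "'t conf option set" where
  "dom = {X. \<forall>C. X = Some C \<longrightarrow> C \<in> D}"

definition typed_dom :: "'t conf option set" where
  "typed_dom = {X \<in> dom. \<forall>C. X = Some C \<longrightarrow> (\<exists>\<Sigma> \<Sigma>'. conf_typed \<Sigma> \<Sigma>' C)}"

lemma typed_dom_subset: "typed_dom \<subseteq> dom"
  by (auto simp: typed_dom_def)

lemma inj_map_option: "inj_on (map_option f) dom"
proof (rule inj_onI)
  fix X Y assume "X \<in> dom" "Y \<in> dom" "map_option f X = map_option f Y"
  then show "X = Y"
    by (cases X; cases Y) (auto simp: dom_def dest: inj_onD[OF inj])
qed

lemma map_pmf_dom_inject:
  assumes "set_pmf \<Delta> \<subseteq> dom" "set_pmf \<Theta> \<subseteq> dom"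
    "map_pmf (map_option f) \<Delta> = map_pmf (map_option f) \<Theta>"
  shows "\<Delta> = \<Theta>"
proof -
  have *: "map_pmf (inv_into dom (map_option f)) (map_pmf (map_option f) \<Xi>) = \<Xi>"
    if "set_pmf \<Xi> \<subseteq> dom" for \<Xi>
    using that inj_map_option
    by (subst map_pmf_comp, intro map_pmf_idI) (auto simp: inv_into_f_f)
  show ?thesis by (rule trans[OF sym[OF *[OF assms(1), unfolded assms(3)]] *[OF assms(2)]])
qed

lemma bot_step_map:
  assumes "X \<in> typed_dom" "bot_step X \<mu> s \<Theta>"
  shows "set_pmf \<Theta> \<subseteq> dom" "bot_step (map_option f X) \<mu> s (map_pmf (map_option f) \<Theta>)"
proof -
  have "set_pmf \<Theta> \<subseteq> dom \<and> bot_step (map_option f X) \<mu> s (map_pmf (map_option f) \<Theta>)"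
    using assms(2)
  proof cases
    case (bs_step C \<Delta>)
    with assms(1) obtain \<Sigma> \<Sigma>' where C: "C \<in> D" "conf_typed \<Sigma> \<Sigma>' C"
      by (auto simp: typed_dom_def dom_def)
    have "map_pmf (map_option f) (map_pmf Some \<Delta>) = map_pmf Some (map_pmf f \<Delta>)"
      by (simp add: map_pmf_comp)
    with bs_step step_closed[OF C bs_step(3)] bot_step.bs_step[OF step_map[OF C bs_step(3)]]
    show ?thesis by (auto simp: dom_def)
  next
    case bs_bot
    \<comment> \<open>The rule for \<bottom> has a negative premise, so transporting it forward
      requires that steps be reflected.\<close>
    have "\<nexists>C \<Delta>. map_option f X = Some C \<and> step C \<mu> s \<Delta>"
    proof (rule notI, elim exE conjE)
      fix C' \<Delta>' assume "map_option f X = Some C'" "step C' \<mu> s \<Delta>'"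
      moreover from this(1) obtain C where C: "X = Some C" "C' = f C" by auto
      moreover from this assms(1) obtain \<Sigma> \<Sigma>' where "C \<in> D" "conf_typed \<Sigma> \<Sigma>' C"
        by (auto simp: typed_dom_def dom_def)
      ultimately show False using step_map_inv bs_bot(2) by blast
    qed
    from bot_step.bs_bot[OF this] bs_bot(1) show ?thesis by (simp add: dom_def)
  qed
  then show "set_pmf \<Theta> \<subseteq> dom" "bot_step (map_option f X) \<mu> s (map_pmf (map_option f) \<Theta>)"
    by simp_all
qed

lemma bot_step_map_inv:
  assumes "X \<in> typed_dom" "bot_step (map_option f X) \<mu> s \<Theta>'"
  shows "\<exists>\<Theta>. bot_step X \<mu> s \<Theta> \<and> \<Theta>' = map_pmf (map_option f) \<Theta>"
  using assms(2)
proof cases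
  case (bs_step C' \<Delta>')
  then obtain C where X: "X = Some C" "C' = f C" by auto
  with assms(1) obtain \<Sigma> \<Sigma>' where C: "C \<in> D" "conf_typed \<Sigma> \<Sigma>' C"
    by (auto simp: typed_dom_def dom_def)
  with step_map_inv[OF C] bs_step(3) X(2) obtain \<Delta> where \<Delta>: "step C \<mu> s \<Delta>" "\<Delta>' = map_pmf f \<Delta>"
    by blast
  have "map_pmf (map_option f) (map_pmf Some \<Delta>) = map_pmf Some (map_pmf f \<Delta>)"
    by (simp add: map_pmf_comp)
  with bot_step.bs_step[OF \<Delta>(1)] X \<Delta> bs_step show ?thesis by auto
next
  case bs_bot
  \<comment> \<open>Dually, absence of steps pulls back because steps push forward.\<close>
  have "\<nexists>C \<Delta>. X = Some C \<and> step C \<mu> s \<Delta>"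
  proof (rule notI, elim exE conjE)
    fix C \<Delta> assume *: "X = Some C" "step C \<mu> s \<Delta>"
    with assms(1) obtain \<Sigma> \<Sigma>' where "C \<in> D" "conf_typed \<Sigma> \<Sigma>' C"
      by (auto simp: typed_dom_def dom_def)
    from step_map[OF this *(2)] bs_bot(2) *(1) show False by auto
  qed
  from bot_step.bs_bot[OF this] bs_bot(1) show ?thesis by auto
qed

lemma sched_step_map:
  assumes "X \<in> typed_dom" "sched_step X \<mu> \<delta> \<Theta>"
  shows "set_pmf \<Theta> \<subseteq> dom" "sched_step (map_option f X) \<mu> \<delta> (map_pmf (map_option f) \<Theta>)"
proof -
  have "set_pmf \<Theta> \<subseteq> dom \<and> sched_step (map_option f X) \<mu> \<delta> (map_pmf (map_option f) \<Theta>)"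
    using assms(2)
  proof cases
    case (1 J s \<Xi>)
    have "sched_step (map_option f X) \<mu> (map_pmf s J) (bind_pmf J (\<lambda>j. map_pmf (map_option f) (\<Xi> j)))"
      using 1 bot_step_map(2)[OF assms(1)] by (intro sched_step.intros) auto
    moreover have "set_pmf \<Theta> \<subseteq> dom" using 1 bot_step_map(1)[OF assms(1)] by (auto simp: subset_iff)
    ultimately show ?thesis using 1 by (simp add: map_bind_pmf)
  qed
  then show "set_pmf \<Theta> \<subseteq> dom" "sched_step (map_option f X) \<mu> \<delta> (map_pmf (map_option f) \<Theta>)"
    by simp_all
qed

lemma sched_step_map_inv:
  assumes "X \<in> typed_dom" "sched_step (map_option f X) \<mu> \<delta> \<Theta>'"
  shows "\<exists>\<Theta>. sched_step X \<mu> \<delta> \<Theta> \<and> \<Theta>' = map_pmf (map_option f) \<Theta>"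
  using assms(2)
proof cases
  case (1 J s \<Xi>')
  with bot_step_map_inv[OF assms(1)]
  have "\<forall>j \<in> set_pmf J. \<exists>\<Xi>. bot_step X \<mu> (s j) \<Xi> \<and> \<Xi>' j = map_pmf (map_option f) \<Xi>" by blast
  then obtain \<Xi> where \<Xi>: "\<forall>j \<in> set_pmf J. bot_step X \<mu> (s j) (\<Xi> j) \<and> \<Xi>' j = map_pmf (map_option f) (\<Xi> j)"
    by metis
  then have "sched_step X \<mu> (map_pmf s J) (bind_pmf J \<Xi>)"
    using 1 by (intro sched_step.intros) auto
  moreover have "bind_pmf J \<Xi>' = map_pmf (map_option f) (bind_pmf J \<Xi>)"
    unfolding map_bind_pmf using \<Xi> by (intro bind_pmf_cong) auto
  ultimately show ?thesis using 1 by blast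
qed

lemma dist_step_map:
  assumes "set_pmf \<Delta> \<subseteq> typed_dom" "dist_step \<Delta> \<mu> \<delta> \<Delta>'"
  shows "set_pmf \<Delta>' \<subseteq> dom"
    "dist_step (map_pmf (map_option f) \<Delta>) \<mu> \<delta> (map_pmf (map_option f) \<Delta>')"
proof -
  have "set_pmf \<Delta>' \<subseteq> dom \<and>
      dist_step (map_pmf (map_option f) \<Delta>) \<mu> \<delta> (map_pmf (map_option f) \<Delta>')"
    using assms(2)
  proof cases
    case (1 I X \<Xi>)
    with assms(1) have X: "X i \<in> typed_dom" if "i \<in> set_pmf I" for i using that by auto
    have "dist_step (map_pmf (\<lambda>i. map_option f (X i)) I) \<mu> \<delta>
        (bind_pmf I (\<lambda>i. map_pmf (map_option f) (\<Xi> i)))"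
      using 1 sched_step_map(2)[OF X] by (intro dist_step.intros) auto
    moreover have "set_pmf \<Delta>' \<subseteq> dom" using 1 sched_step_map(1)[OF X] by (auto simp: subset_iff)
    ultimately show ?thesis using 1 by (simp add: map_bind_pmf map_pmf_comp)
  qed
  then show "set_pmf \<Delta>' \<subseteq> dom"
    "dist_step (map_pmf (map_option f) \<Delta>) \<mu> \<delta> (map_pmf (map_option f) \<Delta>')"
    by simp_all
qed

lemma dist_step_map_inv:
  assumes "set_pmf \<Delta> \<subseteq> typed_dom" "dist_step (map_pmf (map_option f) \<Delta>) \<mu> \<delta> \<Delta>'"
  shows "\<exists>\<Delta>0. dist_step \<Delta> \<mu> \<delta> \<Delta>0 \<and> \<Delta>' = map_pmf (map_option f) \<Delta>0"
  using assms(2)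
proof cases
  case (1 I X' \<Xi>')
  \<comment> \<open>The given decomposition splits the image of \<open>\<Delta>\<close>; its points
    are pulled back while the index distribution is kept.\<close>
  define X where "X i = inv_into dom (map_option f) (X' i)" for i
  have X': "X' ` set_pmf I = map_option f ` set_pmf \<Delta>" using 1(1) by (metis set_map_pmf)
  have X: "X i \<in> typed_dom \<and> X' i = map_option f (X i)" if "i \<in> set_pmf I" for i
  proof -
    from that X' obtain Y where Y: "Y \<in> set_pmf \<Delta>" "X' i = map_option f Y" by auto
    with assms(1) typed_dom_subset inj_map_option have "X i = Y"
      by (simp add: X_def inv_into_f_f subset_iff)
    with Y assms(1) show ?thesis by auto
  qed
  \<comment> \<open>Equal images, together with injectivity on distributions over
    \<open>dom\<close>, show that \<open>X\<close> decomposes \<open>\<Delta>\<close>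
    itself.\<close>
  have "map_pmf (map_option f) (map_pmf X I) = map_pmf (map_option f) \<Delta>"
    unfolding 1(1) map_pmf_comp using X by (intro map_pmf_cong) auto
  then have \<Delta>: "map_pmf X I = \<Delta>"
  proof (rule map_pmf_dom_inject[rotated 2])
    show "set_pmf (map_pmf X I) \<subseteq> dom" using X typed_dom_subset unfolding set_map_pmf by blast
    show "set_pmf \<Delta> \<subseteq> dom" using assms(1) typed_dom_subset by simp
  qed
  have "\<forall>i \<in> set_pmf I. \<exists>\<Xi>. sched_step (X i) \<mu> \<delta> \<Xi> \<and> \<Xi>' i = map_pmf (map_option f) \<Xi>"
    using 1(4) X sched_step_map_inv by metis
  then obtain \<Xi> where \<Xi>: "\<forall>i \<in> set_pmf I. sched_step (X i) \<mu> \<delta> (\<Xi> i) \<and> \<Xi>' i = map_pmf (map_option f) (\<Xi> i)"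
    by metis
  have "dist_step (map_pmf X I) \<mu> \<delta> (bind_pmf I \<Xi>)"
    using 1 \<Xi> by (intro dist_step.intros) auto
  moreover have "bind_pmf I \<Xi>' = map_pmf (map_option f) (bind_pmf I \<Xi>)"
    unfolding map_bind_pmf using \<Xi> by (intro bind_pmf_cong) auto
  ultimately show ?thesis using 1 \<Delta> by blast
qed

lemma deterministic_map_iff:
  assumes "set_pmf \<Delta> \<subseteq> typed_dom"
  shows "deterministic (map_pmf (map_option f) \<Delta>) \<longleftrightarrow> deterministic \<Delta>"
  unfolding deterministic_def
  using dist_step_map[OF assms] dist_step_map_inv[OF assms] map_pmf_dom_inject by metis

text \<open>\<open>reachable\<close> records a type for each target, which supplies the
  well-typedness required to transport the next step.\<close>

lemma reachable_map:
  assumes "reachable C C'" "C \<in> D" "conf_typed \<Sigma> \<Sigma>' C"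
  shows "C' \<in> D \<and> (\<exists>\<Sigma> \<Sigma>'. conf_typed \<Sigma> \<Sigma>' C') \<and> reachable (f C) (f C')"
  using assms
proof (induction arbitrary: \<Sigma> \<Sigma>' rule: reachable.induct)
  case (1 C)
  then show ?case by (auto intro: reachable.intros)
next
  case (2 C C' \<mu> s \<Delta> C'' \<Sigma>1 \<Sigma>1')
  from 2(5)[OF 2(6,7)] obtain \<Sigma>2 \<Sigma>2' where
    C': "C' \<in> D" "conf_typed \<Sigma>2 \<Sigma>2' C'" "reachable (f C) (f C')" by blast
  have "C'' \<in> D" using step_closed[OF C'(1,2) 2(2)] 2(3) by blast
  moreover have "reachable (f C) (f C'')"
  proof (rule reachable.intros(2)[OF C'(3) step_map[OF C'(1,2) 2(2)]])
    show "f C'' \<in> set_pmf (map_pmf f \<Delta>)" using 2(3) by simp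
    show "conf_typed \<Sigma>1 \<Sigma>1' (f C'')" using \<open>C'' \<in> D\<close> 2(4) by (simp add: typed_iff)
  qed
  ultimately show ?case using 2(4) by blast
qed

lemma reachable_map_inv:
  assumes "reachable C1 C2" "C1 = f C" "C \<in> D" "conf_typed \<Sigma> \<Sigma>' C"
  shows "\<exists>C' \<in> D. C2 = f C' \<and> reachable C C'"
  using assms
proof (induction arbitrary: \<Sigma> \<Sigma>' rule: reachable.induct)
  case (1 C)
  then show ?case by (auto intro: reachable.intros)
next
  case (2 C1 C2 \<mu> s \<Delta>' C3 \<Sigma>1 \<Sigma>1')
  from 2(5)[OF 2(6-8)] obtain C' where C': "C' \<in> D" "C2 = f C'" "reachable C C'" by blast
  from reachable_map[OF C'(3) 2(7,8)] obtain \<Sigma>2 \<Sigma>2' where ty: "conf_typed \<Sigma>2 \<Sigma>2' C'" by blast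
  from step_map_inv[OF C'(1) ty] 2(2) C'(2)
  obtain \<Delta> where \<Delta>: "step C' \<mu> s \<Delta>" "\<Delta>' = map_pmf f \<Delta>" by blast
  with 2(3) obtain C'' where C'': "C'' \<in> set_pmf \<Delta>" "C3 = f C''" by auto
  have "C'' \<in> D" using step_closed[OF C'(1) ty \<Delta>(1)] C''(1) by blast
  moreover from this 2(4) C''(2) have "conf_typed \<Sigma>1 \<Sigma>1' C''" by (simp add: typed_iff)
  ultimately show ?case using reachable.intros(2)[OF C'(3) \<Delta>(1) C''(1)] C''(2) by blast
qed

lemma deterministically_tagged_map_iff:
  assumes "set_pmf \<Delta> \<subseteq> typed_dom"
  shows "deterministically_tagged (map_pmf (map_option f) \<Delta>) \<longleftrightarrow> deterministically_tagged \<Delta>"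
proof
  assume *: "deterministically_tagged (map_pmf (map_option f) \<Delta>)"
  show "deterministically_tagged \<Delta>"
    unfolding deterministically_tagged_def
  proof (intro allI impI)
    fix \<Theta> :: "'t dist"
    assume fin: "finite (set_pmf \<Theta>)"
      and re: "\<forall>C'. Some C' \<in> set_pmf \<Theta> \<longrightarrow> (\<exists>C. Some C \<in> set_pmf \<Delta> \<and> reachable C C')"
    have td: "set_pmf \<Theta> \<subseteq> typed_dom"
    proof
      fix X assume "X \<in> set_pmf \<Theta>"
      with re assms reachable_map show "X \<in> typed_dom"
        unfolding typed_dom_def dom_def by (cases X) (force, blast)
    qed
    have "deterministic (map_pmf (map_option f) \<Theta>)"
      using *[unfolded deterministically_tagged_def, rule_format]
    proof this
      show "finite (set_pmf (map_pmf (map_option f) \<Theta>))" using fin by simp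
      fix C' assume "Some C' \<in> set_pmf (map_pmf (map_option f) \<Theta>)"
      then obtain C1 where C1: "Some C1 \<in> set_pmf \<Theta>" "C' = f C1" by (auto simp: Some_in_map_option_image)
      with re obtain C where C: "Some C \<in> set_pmf \<Delta>" "reachable C C1" by blast
      with assms obtain \<Sigma> \<Sigma>' where "C \<in> D" "conf_typed \<Sigma> \<Sigma>' C"
        by (force simp: typed_dom_def dom_def)
      from reachable_map[OF C(2) this] C1 C
      show "\<exists>C. Some C \<in> set_pmf (map_pmf (map_option f) \<Delta>) \<and> reachable C C'" by force
    qed
    then show "deterministic \<Theta>" using deterministic_map_iff[OF td] by simp
  qed
next
  assume *: "deterministically_tagged \<Delta>"
  show "deterministically_tagged (map_pmf (map_option f) \<Delta>)"
    unfolding deterministically_tagged_def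
  proof (intro allI impI)
    fix \<Theta>' :: "'t dist"
    assume fin: "finite (set_pmf \<Theta>')"
      and re: "\<forall>C'. Some C' \<in> set_pmf \<Theta>' \<longrightarrow>
        (\<exists>C. Some C \<in> set_pmf (map_pmf (map_option f) \<Delta>) \<and> reachable C C')"
    \<comment> \<open>A distribution over what is reachable from the image is pulled back along the
      inverse: \<bottom> is fixed, and every other point has a preimage reachable from
      \<open>\<Delta>\<close>.\<close>
    define g where "g = inv_into dom (map_option f)"
    define \<Theta> where "\<Theta> = map_pmf g \<Theta>'"
    have g: "g X \<in> typed_dom \<and> map_option f (g X) = X \<and>
        (\<forall>C'. g X = Some C' \<longrightarrow> (\<exists>C. Some C \<in> set_pmf \<Delta> \<and> reachable C C'))"
      if X: "X \<in> set_pmf \<Theta>'" for X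
    proof (cases X)
      case None
      have "g None = None"
        using inv_into_f_f[OF inj_map_option, of None] by (simp add: g_def dom_def)
      with None show ?thesis by (simp add: typed_dom_def dom_def)
    next
      case (Some C2)
      with X re obtain C where C: "Some C \<in> set_pmf \<Delta>" "reachable (f C) C2"
        by (auto simp: Some_in_map_option_image)
      with assms obtain \<Sigma> \<Sigma>' where ty: "C \<in> D" "conf_typed \<Sigma> \<Sigma>' C"
        by (force simp: typed_dom_def dom_def)
      from reachable_map_inv[OF C(2) refl ty]
      obtain C' where C': "C' \<in> D" "C2 = f C'" "reachable C C'" by blast
      have "g X = Some C'"
        using inv_into_f_f[OF inj_map_option, of "Some C'"] Some C' by (simp add: g_def dom_def)
      with C' reachable_map[OF C'(3) ty] Some C(1) show ?thesis by (auto simp: typed_dom_def dom_def)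
    qed
    have "deterministic \<Theta>"
      using *[unfolded deterministically_tagged_def, rule_format]
    proof this
      show "finite (set_pmf \<Theta>)" using fin by (simp add: \<Theta>_def)
      fix C' assume "Some C' \<in> set_pmf \<Theta>"
      then show "\<exists>C. Some C \<in> set_pmf \<Delta> \<and> reachable C C'" using g by (auto simp: \<Theta>_def)
    qed
    moreover have "set_pmf \<Theta> \<subseteq> typed_dom" using g by (auto simp: \<Theta>_def)
    moreover have "map_pmf (map_option f) \<Theta> = \<Theta>'"
      unfolding \<Theta>_def using g by (subst map_pmf_comp, intro map_pmf_idI) auto
    ultimately show "deterministic \<Theta>'" using deterministic_map_iff by metis
  qed
qed

lemma dist_typed_map_iff:
  assumes "set_pmf \<Delta> \<subseteq> dom"
  shows "dist_typed \<Sigma> \<Sigma>' (map_pmf (map_option f) \<Delta>) \<longleftrightarrow> dist_typed \<Sigma> \<Sigma>' \<Delta>"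
proof -
  have "Some C \<in> set_pmf \<Delta> \<Longrightarrow> C \<in> D" for C using assms by (auto simp: dom_def)
  then show ?thesis
    by (auto simp: dist_typed_def Some_in_map_option_image typed_iff)
qed

lemma admissible_map_iff:
  assumes "set_pmf \<Delta> \<subseteq> dom"
  shows "admissible (map_pmf (map_option f) \<Delta>) \<longleftrightarrow> admissible \<Delta>"
proof -
  have fin: "finite (map_option f ` set_pmf \<Delta>) \<longleftrightarrow> finite (set_pmf \<Delta>)"
    using inj_map_option assms by (intro finite_image_iff) (rule inj_on_subset)
  have "set_pmf \<Delta> \<subseteq> typed_dom" if "dist_typed \<Sigma> \<Sigma>' \<Delta>" for \<Sigma> \<Sigma>'
    using assms that by (auto simp: typed_dom_def dist_typed_def)
  then show ?thesis
    using deterministically_tagged_map_iff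
    unfolding admissible_def dist_typed_map_iff[OF assms] set_map_pmf fin by blast
qed

end

lemma step_iso_id: "step_iso UNIV id"
  by unfold_locales auto

lemma step_iso_comp:
  assumes "step_iso D f" "step_iso E g"
  shows "step_iso {C \<in> D. f C \<in> E} (g \<circ> f)"
proof -
  interpret f: step_iso D f by fact
  interpret g: step_iso E g by fact
  show ?thesis
  proof
    show "inj_on (g \<circ> f) {C \<in> D. f C \<in> E}"
      using f.inj g.inj by (auto simp: inj_on_def)
  next
    fix C \<Sigma> \<Sigma>' assume "C \<in> {C \<in> D. f C \<in> E}"
    then have CD: "C \<in> D" "f C \<in> E" by auto
    show "conf_typed \<Sigma> \<Sigma>' ((g \<circ> f) C) \<longleftrightarrow> conf_typed \<Sigma> \<Sigma>' C"
      using CD by (simp add: f.typed_iff g.typed_iff)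
    assume ty: "conf_typed \<Sigma> \<Sigma>' C"
    then have ty': "conf_typed \<Sigma> \<Sigma>' (f C)" using CD by (simp add: f.typed_iff)
    fix \<mu> s
    {
      fix \<Delta> assume st: "step C \<mu> s \<Delta>"
      note st' = f.step_map[OF CD(1) ty st]
      show "set_pmf \<Delta> \<subseteq> {C \<in> D. f C \<in> E}"
        using f.step_closed[OF CD(1) ty st] g.step_closed[OF CD(2) ty' st'] by auto
      show "step ((g \<circ> f) C) \<mu> s (map_pmf (g \<circ> f) \<Delta>)"
        using g.step_map[OF CD(2) ty' st'] by (simp add: map_pmf_compose)
    }
    fix \<Delta>' assume "step ((g \<circ> f) C) \<mu> s \<Delta>'"
    then show "\<exists>\<Delta>. step C \<mu> s \<Delta> \<and> \<Delta>' = map_pmf (g \<circ> f) \<Delta>"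
      using f.step_map_inv[OF CD(1) ty] g.step_map_inv[OF CD(2) ty']
      by (fastforce simp: map_pmf_compose)
  qed
qed


section \<open>Derivatives of distributions\<close>

lemma convex_hull_mono: "R \<le> R' \<Longrightarrow> convex_hull R \<le> convex_hull R'"
  by (force elim!: convex_hull.cases intro!: convex_hull.intros)

lemma convex_hullI:
  assumes "R \<Delta> \<Theta>"
  shows "convex_hull R \<Delta> \<Theta>"
  using convex_hull.intros[of "return_pmf 0" R "\<lambda>_. \<Delta>" "\<lambda>_. \<Theta>"] assms
  by (simp add: bind_return_pmf)

lemma convex_hull_converse: "convex_hull (\<lambda>\<Delta> \<Theta>. R \<Theta> \<Delta>) \<Delta> \<Theta> \<longleftrightarrow> convex_hull R \<Theta> \<Delta>"
  by (auto elim!: convex_hull.cases intro!: convex_hull.intros)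

text \<open>A combination of combinations is a combination over pairs of indices;
  \<open>prod_encode\<close> brings the pairs back to the index type \<open>nat\<close>.\<close>

lemma convex_hull_bind:
  assumes "finite (set_pmf (I :: nat pmf))" "\<forall>i \<in> set_pmf I. convex_hull R (\<Delta> i) (\<Theta> i)"
  shows "convex_hull R (bind_pmf I \<Delta>) (bind_pmf I \<Theta>)"
proof -
  have "\<exists>J A B. finite (set_pmf (J :: nat pmf)) \<and> (\<forall>j \<in> set_pmf J. R (A j) (B j)) \<and>
      \<Delta> i = bind_pmf J A \<and> \<Theta> i = bind_pmf J B" if "i \<in> set_pmf I" for i
    using bspec[OF assms(2) that] by cases blast
  then obtain J A B where J: "\<And>i. i \<in> set_pmf I \<Longrightarrow> finite (set_pmf (J i :: nat pmf)) \<and>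
      (\<forall>j \<in> set_pmf (J i). R (A i j) (B i j)) \<and> \<Delta> i = bind_pmf (J i) (A i) \<and> \<Theta> i = bind_pmf (J i) (B i)"
    by metis
  define K where "K = bind_pmf I (\<lambda>i. map_pmf (\<lambda>j. prod_encode (i, j)) (J i))"
  have "convex_hull R (bind_pmf K (\<lambda>k. case_prod A (prod_decode k)))
      (bind_pmf K (\<lambda>k. case_prod B (prod_decode k)))"
    using J assms(1) by (intro convex_hull.intros) (auto simp: K_def)
  moreover have "bind_pmf K (\<lambda>k. case_prod A (prod_decode k)) = bind_pmf I \<Delta>"
    "bind_pmf K (\<lambda>k. case_prod B (prod_decode k)) = bind_pmf I \<Theta>"
    unfolding K_def bind_assoc_pmf bind_map_pmf prod_encode_inverse prod.case
    using J by (auto intro!: bind_pmf_cong)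
  ultimately show ?thesis by simp
qed

text \<open>Each point of the support serves as its own index. Indices are natural numbers, so the
  finite support is numbered injectively.\<close>

lemma dist_stepI:
  assumes fin: "finite (set_pmf \<Delta>)" and st: "\<forall>X \<in> set_pmf \<Delta>. sched_step X \<mu> \<delta> (F X)"
  shows "dist_step \<Delta> \<mu> \<delta> (bind_pmf \<Delta> F)"
proof -
  obtain h :: "_ \<Rightarrow> nat" where h: "inj_on h (set_pmf \<Delta>)"
    using finite_imp_inj_to_nat_seg[OF fin] by blast
  define X where "X = inv_into (set_pmf \<Delta>) h"
  have X: "X (h x) = x" if "x \<in> set_pmf \<Delta>" for x using h that by (simp add: X_def)
  have "dist_step (map_pmf X (map_pmf h \<Delta>)) \<mu> \<delta> (bind_pmf (map_pmf h \<Delta>) (\<lambda>i. F (X i)))"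
    using fin st X by (intro dist_step.intros) auto
  moreover have "map_pmf X (map_pmf h \<Delta>) = \<Delta>"
    unfolding map_pmf_comp using X by (intro map_pmf_idI)
  moreover have "bind_pmf (map_pmf h \<Delta>) (\<lambda>i. F (X i)) = bind_pmf \<Delta> F"
    unfolding bind_map_pmf using X by (intro bind_pmf_cong) auto
  ultimately show ?thesis by simp
qed

text \<open>Reachability is reflexive, so deterministic tagging covers the point distribution on
  \<open>X\<close>, whose steps include those of \<open>X\<close>.\<close>

lemma sched_step_unique:
  assumes "deterministically_tagged \<Delta>" "X \<in> set_pmf \<Delta>"
    and "sched_step X \<mu> \<delta> \<Theta>" "sched_step X \<mu> \<delta> \<Theta>'"
  shows "\<Theta> = \<Theta>'"
proof -
  have "deterministic (return_pmf X)"
  proof (rule assms(1)[unfolded deterministically_tagged_def, rule_format])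
    fix C' assume "Some C' \<in> set_pmf (return_pmf X)"
    with assms(2) show "\<exists>C. Some C \<in> set_pmf \<Delta> \<and> reachable C C'"
      by (auto intro: reachable.intros(1))
  qed simp
  moreover have "dist_step (return_pmf X) \<mu> \<delta> \<Xi>" if "sched_step X \<mu> \<delta> \<Xi>" for \<Xi>
    using dist_stepI[of "return_pmf X" \<mu> \<delta> "\<lambda>_. \<Xi>"] that by (simp add: bind_return_pmf)
  ultimately show ?thesis using assms(3,4) unfolding deterministic_def by blast
qed

text \<open>Meaningful only at points with exactly one derivative. As a kernel it makes steps linear
  in the source, hence compatible with convex combinations.\<close>

definition derivative :: "act \<Rightarrow> 't sched pmf \<Rightarrow> 't conf option \<Rightarrow> 't dist" where
  "derivative \<mu> \<delta> X = (THE \<Theta>. sched_step X \<mu> \<delta> \<Theta>)"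

text \<open>A decomposition may list a point repeatedly, but uniqueness gives all copies the same
  derivative. The larger support of \<open>\<Delta>\<close> lets a component inherit determinism
  from a whole combination.\<close>

lemma dist_step_derivative:
  assumes det: "deterministically_tagged \<Delta>" and sub: "set_pmf \<Delta>0 \<subseteq> set_pmf \<Delta>"
    and st: "dist_step \<Delta>0 \<mu> \<delta> \<Delta>'"
  shows "\<Delta>' = bind_pmf \<Delta>0 (derivative \<mu> \<delta>)"
    and "\<forall>X \<in> set_pmf \<Delta>0. sched_step X \<mu> \<delta> (derivative \<mu> \<delta> X)"
proof -
  have *: "derivative \<mu> \<delta> X = \<Theta>" if "X \<in> set_pmf \<Delta>0" "sched_step X \<mu> \<delta> \<Theta>" for X \<Theta>
    unfolding derivative_def using that sched_step_unique[OF det] sub by blast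
  from st have "\<Delta>' = bind_pmf \<Delta>0 (derivative \<mu> \<delta>) \<and>
    (\<forall>X \<in> set_pmf \<Delta>0. sched_step X \<mu> \<delta> (derivative \<mu> \<delta> X))"
  proof cases
    case (1 I X \<Theta>)
    have D: "derivative \<mu> \<delta> (X i) = \<Theta> i" if "i \<in> set_pmf I" for i
      using 1 that by (intro *) auto
    have "bind_pmf I \<Theta> = bind_pmf (map_pmf X I) (derivative \<mu> \<delta>)"
      unfolding bind_map_pmf using D by (intro bind_pmf_cong) auto
    with 1 D show ?thesis by auto
  qed
  then show "\<Delta>' = bind_pmf \<Delta>0 (derivative \<mu> \<delta>)"
    "\<forall>X \<in> set_pmf \<Delta>0. sched_step X \<mu> \<delta> (derivative \<mu> \<delta> X)" by simp_all
qed

lemma dist_step_target: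
  assumes "dist_step \<Delta> \<mu> \<delta> \<Delta>'" "Some C' \<in> set_pmf \<Delta>'"
  shows "\<exists>C s \<Xi>. Some C \<in> set_pmf \<Delta> \<and> step C \<mu> s \<Xi> \<and> C' \<in> set_pmf \<Xi>"
  using assms(1)
proof cases
  case (1 I X \<Theta>)
  with assms(2) obtain i where i: "i \<in> set_pmf I" "Some C' \<in> set_pmf (\<Theta> i)" "sched_step (X i) \<mu> \<delta> (\<Theta> i)"
    by auto
  from i(3) show ?thesis
  proof cases
    case s: (1 J s \<Theta>')
    with i(2) obtain j where j: "Some C' \<in> set_pmf (\<Theta>' j)" "bot_step (X i) \<mu> (s j) (\<Theta>' j)" by auto
    from j(2) show ?thesis
    proof cases
      case (bs_step C \<Xi>)
      have "Some C \<in> set_pmf \<Delta>" using 1(1) i(1) bs_step(1) by (metis imageI set_map_pmf)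
      with bs_step j(1) show ?thesis by auto
    qed (use j(1) in simp)
  qed
qed

text \<open>Subject reduction yields \<open>\<Sigma>'\<close>, and transitions keep the set of
  qubits of the state; density and closedness are read off the individual types assumed for the
  targets.\<close>

lemma dist_step_typed:
  assumes st: "dist_step \<Delta> ATau \<delta> \<Delta>'" and ty: "dist_typed \<Sigma> \<Sigma>' \<Delta>"
    and ty': "\<And>C. Some C \<in> set_pmf \<Delta>' \<Longrightarrow> \<exists>\<Sigma> \<Sigma>'. conf_typed \<Sigma> \<Sigma>' C"
  shows "dist_typed \<Sigma> \<Sigma>' \<Delta>'"
  unfolding dist_typed_def
proof (intro allI impI)
  fix C' assume C': "Some C' \<in> set_pmf \<Delta>'"
  from dist_step_target[OF st C'] obtain C s \<Xi> where
    C: "Some C \<in> set_pmf \<Delta>" "step C ATau s \<Xi>" "C' \<in> set_pmf \<Xi>" by blast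
  have t: "conf_typed \<Sigma> \<Sigma>' C" using ty C(1) by (simp add: dist_typed_def)
  obtain S \<rho> P where [simp]: "C = Conf S \<rho> P" by (cases C)
  from step_state_space[OF C(2) _ C(3)] obtain \<rho>' P' where [simp]: "C' = Conf S \<rho>' P'" by auto
  have "names \<Sigma>' \<turnstile> P'"
    using subject_reduction[OF C(2), of S \<rho> P "names \<Sigma>'" S \<rho>' P'] t C(3) by simp
  with t ty'[OF C'] show "conf_typed \<Sigma> \<Sigma>' C'" by auto
qed

text \<open>What is reachable from a target is reachable from a source with one more step, which
  \<open>reachable\<close> accepts because the target is typed.\<close>

lemma dist_step_deterministically_tagged:
  assumes st: "dist_step \<Delta> \<mu> \<delta> \<Delta>'" and det: "deterministically_tagged \<Delta>"
    and ty': "\<And>C. Some C \<in> set_pmf \<Delta>' \<Longrightarrow> \<exists>\<Sigma> \<Sigma>'. conf_typed \<Sigma> \<Sigma>' C"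
  shows "deterministically_tagged \<Delta>'"
proof -
  have trans: "reachable C C''" if "reachable C' C''" "reachable C C'" for C C' C'' :: "'t conf"
    using that by (induction) (auto intro: reachable.intros(2))
  have "\<exists>C. Some C \<in> set_pmf \<Delta> \<and> reachable C C''" if C': "Some C' \<in> set_pmf \<Delta>'" "reachable C' C''" for C' C''
  proof -
    from dist_step_target[OF st C'(1)] obtain C s \<Xi> where
      C: "Some C \<in> set_pmf \<Delta>" "step C \<mu> s \<Xi>" "C' \<in> set_pmf \<Xi>" by blast
    from ty'[OF C'(1)] obtain \<Sigma> \<Sigma>' where "conf_typed \<Sigma> \<Sigma>' C'" by blast
    from reachable.intros(2)[OF reachable.intros(1) C(2,3) this] C'(2) C(1) show ?thesis
      using trans by blast
  qed
  then show ?thesis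
    using det unfolding deterministically_tagged_def by meson
qed

section \<open>Types and definedness of plugged distributions\<close>

lemma names_Un_Diff: "A \<subseteq> B \<Longrightarrow> names A \<union> names (B - A) = names B"
  by auto

lemma plug_typed:
  assumes "dist_typed \<Sigma>0 \<Sigma>0' \<Delta>" "ctx_typed \<Sigma>1 B" "\<forall>C. Some C \<in> set_pmf \<Delta> \<longrightarrow> hole_fits B \<Sigma>1 C"
  shows "dist_typed \<Sigma>0 \<Sigma>1 (plug B \<Delta>)"
proof -
  obtain \<Sigma> Q where [simp]: "B = Ctx \<Sigma> Q" by (cases B)
  show ?thesis
    unfolding dist_typed_def
  proof (intro allI impI)
    fix C' assume "Some C' \<in> set_pmf (plug B \<Delta>)"
    then obtain C where C: "Some C \<in> set_pmf \<Delta>" "C' = par_right Q C"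
      by (auto simp: Some_in_map_option_image)
    have "conf_typed \<Sigma>0 \<Sigma>0' C" using assms(1) C(1) by (simp add: dist_typed_def)
    moreover have "hole_fits B \<Sigma>1 C" using assms(3) C(1) by simp
    moreover obtain S \<rho> P where [simp]: "C = Conf S \<rho> P" by (cases C)
    ultimately have fit: "conf_typed \<Sigma>0 \<Sigma>0' (Conf S \<rho> P)" "names \<Sigma> \<turnstile> P" "\<Sigma>1 \<subseteq> S" by auto
    moreover have "names \<Sigma> \<union> names (\<Sigma>1 - \<Sigma>) \<turnstile> Par P Q"
      using fit(2) assms(2) by (intro t_par) auto
    ultimately show "conf_typed \<Sigma>0 \<Sigma>1 C'"
      using assms(2) C(2) by (auto simp: closed_proc_def names_Un_Diff)
  qed
qed

text \<open>A priori the two sides fill the context at different outer types. Unique typing of the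
  shared \<open>Q\<close> fixes the part outside the hole, and the hole is shared as well.\<close>

lemma plug_common_type:
  assumes ty: "dist_typed \<Sigma>0 \<Sigma>0' \<Delta>" "dist_typed \<Sigma>0 \<Sigma>0' \<Theta>"
    and def: "plug_defined B \<Delta>" "plug_defined B \<Theta>"
  shows "\<exists>\<Sigma> \<Sigma>'. dist_typed \<Sigma> \<Sigma>' (plug B \<Delta>) \<and> dist_typed \<Sigma> \<Sigma>' (plug B \<Theta>)"
proof -
  obtain \<Sigma> Q where [simp]: "B = Ctx \<Sigma> Q" by (cases B)
  from def obtain \<Sigma>1 \<Sigma>2 where
    1: "ctx_typed \<Sigma>1 B" "\<forall>C. Some C \<in> set_pmf \<Delta> \<longrightarrow> hole_fits B \<Sigma>1 C" and
    2: "ctx_typed \<Sigma>2 B" "\<forall>C. Some C \<in> set_pmf \<Theta> \<longrightarrow> hole_fits B \<Sigma>2 C"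
    unfolding plug_defined_def by blast
  have "\<Sigma>1 - \<Sigma> = \<Sigma>2 - \<Sigma>"
    using 1(1) 2(1) has_type_unique[of "names (\<Sigma>1 - \<Sigma>)" Q "names (\<Sigma>2 - \<Sigma>)"] by simp
  then have "\<Sigma>1 = \<Sigma>2" using 1(1) 2(1) by auto
  with plug_typed[OF ty(1) 1] plug_typed[OF ty(2) 2] show ?thesis by blast
qed

text \<open>Each clause speaks of the support and passes to smaller ones; in this way components of
  a convex combination inherit admissibility.\<close>

lemma admissible_subset:
  assumes "admissible \<Delta>" "set_pmf \<Theta> \<subseteq> set_pmf \<Delta>"
  shows "admissible \<Theta>"
proof -
  have "dist_typed \<Sigma> \<Sigma>' \<Theta>" if "dist_typed \<Sigma> \<Sigma>' \<Delta>" for \<Sigma> \<Sigma>'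
    using that assms(2) by (auto simp: dist_typed_def)
  moreover have "deterministically_tagged \<Theta>" if "deterministically_tagged \<Delta>"
    using that assms(2) unfolding deterministically_tagged_def by (meson subsetD)
  ultimately show ?thesis using assms finite_subset unfolding admissible_def by blast
qed

lemma plug_defined_subset:
  assumes "plug_defined B \<Delta>" "set_pmf \<Theta> \<subseteq> set_pmf \<Delta>"
  shows "plug_defined B \<Theta>"
proof -
  have "set_pmf (plug B \<Theta>) \<subseteq> set_pmf (plug B \<Delta>)"
    using assms(2) by (cases B) auto
  with assms admissible_subset show ?thesis
    unfolding plug_defined_def by blast
qed

lemma plug_bind: "plug B (bind_pmf I \<Delta>) = bind_pmf I (\<lambda>i. plug B (\<Delta> i))"
  by (cases B) (simp add: map_bind_pmf)

lemma pmf_map_option_None: "pmf (map_pmf (map_option f) p) None = pmf p None"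
proof -
  have "map_option f -` {None} = {None}" by auto
  then show ?thesis by (simp add: pmf_map pmf.rep_eq)
qed

lemma pmf_eq_1_iff: "pmf p x = 1 \<longleftrightarrow> p = return_pmf x"
proof
  assume 1: "pmf p x = 1"
  have "y = x" if "y \<in> set_pmf p" for y
  proof (rule ccontr)
    assume "y \<noteq> x"
    then have "measure_pmf.prob p {x, y} = pmf p x + pmf p y"
      by (simp add: measure_measure_pmf_finite)
    with 1 measure_pmf.prob_le_1[of p "{x, y}"] have "pmf p y \<le> 0" by simp
    with that pmf_positive[of y p] show False by simp
  qed
  then show "p = return_pmf x" by (auto simp flip: set_pmf_subset_singleton)
qed simp


section \<open>Iterated contexts\<close>

text \<open>Right-nested, so that it can be the component of one context; \<open>par_all\<close>
  below is the left-nested form that successive contexts produce. The empty list stands for no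
  context, hence \<open>undefined\<close>.\<close>

fun par_list :: "'t proc list \<Rightarrow> 't proc" where
  "par_list [] = undefined"
| "par_list [Q] = Q"
| "par_list (Q # Q' # Qs) = Par Q (par_list (Q' # Qs))"

fun par_all :: "'t proc list \<Rightarrow> 't conf \<Rightarrow> 't conf" where
  "par_all Qs (Conf S \<rho> P) = Conf S \<rho> (foldl Par P Qs)"

lemma par_all_Cons: "par_all (Q # Qs) C = par_all Qs (par_right Q C)"
  by (cases C) simp

lemma par_all_snoc: "par_all (Qs @ [Q]) C = par_right Q (par_all Qs C)"
  by (cases C) simp

lemma par_list_Cons: "Qs \<noteq> [] \<Longrightarrow> par_list (Q # Qs) = Par Q (par_list Qs)"
  by (cases Qs) auto

lemma fv_par_list: "Qs \<noteq> [] \<Longrightarrow> fv (par_list Qs) = (\<Union>Q \<in> set Qs. fv Q)"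
  by (induction Qs rule: par_list.induct) auto

lemma has_type_par_list_snoc:
  "Qs \<noteq> [] \<Longrightarrow> \<Sigma> \<turnstile> par_list Qs \<Longrightarrow> \<Sigma>' \<turnstile> Q \<Longrightarrow> \<Sigma> \<inter> \<Sigma>' = {} \<Longrightarrow> \<Sigma> \<union> \<Sigma>' \<turnstile> par_list (Qs @ [Q])"
proof (induction Qs arbitrary: \<Sigma> rule: par_list.induct)
  case (2 Q0)
  then show ?case by (auto intro: t_par)
next
  case (3 Q0 Q1 Qs)
  from 3(3) obtain \<Sigma>1 \<Sigma>2 where \<Sigma>: "\<Sigma> = \<Sigma>1 \<union> \<Sigma>2" "\<Sigma>1 \<turnstile> Q0" "\<Sigma>2 \<turnstile> par_list (Q1 # Qs)"
      "\<Sigma>1 \<inter> \<Sigma>2 = {}"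
    by (auto elim!: has_type_ParE)
  have "\<Sigma>2 \<union> \<Sigma>' \<turnstile> par_list ((Q1 # Qs) @ [Q])"
    using 3(4,5) \<Sigma> by (intro 3(1)) auto
  then have "\<Sigma>1 \<union> (\<Sigma>2 \<union> \<Sigma>') \<turnstile> Par Q0 (par_list ((Q1 # Qs) @ [Q]))"
    using 3(5) \<Sigma> by (intro t_par) auto
  with \<Sigma>(1) show ?case by (simp add: Un_assoc)
qed simp

lemma has_type_foldl_Par:
  "Qs \<noteq> [] \<Longrightarrow> \<Sigma> \<turnstile> foldl Par P Qs \<longleftrightarrow> \<Sigma> \<turnstile> Par P (par_list Qs)"
proof (induction Qs arbitrary: P rule: par_list.induct)
  case (3 Q Q' Qs)
  \<comment> \<open>Only the outermost element is unfolded, so that the induction hypothesis applies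
    at \<open>Par P Q\<close>.\<close>
  then show ?case by (simp add: has_type_Par_assoc del: foldl_Cons add: foldl_Cons[of _ _ Q])
qed simp_all

section \<open>Flattening iterated contexts\<close>

lemma step_iso_reassoc: "step_iso nested_par reassoc"
proof
  show "inj_on reassoc nested_par"
    by (auto simp: inj_on_def nested_par_def)
next
  fix C :: "'t conf" and \<Sigma> \<Sigma>' assume "C \<in> nested_par"
  then obtain S \<rho> P Q R where C: "C = Conf S \<rho> (Par P (Par Q R))" by (auto simp: nested_par_def)
  show "conf_typed \<Sigma> \<Sigma>' (reassoc C) \<longleftrightarrow> conf_typed \<Sigma> \<Sigma>' C"
    by (simp add: C has_type_Par_assoc closed_proc_def)
  assume "conf_typed \<Sigma> \<Sigma>' C"
  then have ty: "names \<Sigma>' \<turnstile> Par P (Par Q R)" by (simp add: C)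
  show "set_pmf \<Delta> \<subseteq> nested_par" "step (reassoc C) \<mu> s (map_pmf reassoc \<Delta>)"
    if "step C \<mu> s \<Delta>" for \<mu> s \<Delta>
    using step_reassoc[OF ty that[unfolded C]] by (simp_all add: C)
  show "\<exists>\<Delta>. step C \<mu> s \<Delta> \<and> \<Delta>' = map_pmf reassoc \<Delta>"
    if "step (reassoc C) \<mu> s \<Delta>'" for \<mu> s \<Delta>'
    using step_unreassoc[OF ty] that by (simp add: C)
qed

text \<open>The configurations on which \<open>n\<close> successive reassociations all apply, in the
  form that composing \<open>n\<close> copies of the isomorphism produces.\<close>

primrec right_comb :: "nat \<Rightarrow> 't conf set" where
  "right_comb 0 = UNIV"
| "right_comb (Suc n) = {C \<in> nested_par. reassoc C \<in> right_comb n}"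

lemma step_iso_funpow_reassoc: "step_iso (right_comb n) (reassoc ^^ n)"
proof (induction n)
  case 0
  then show ?case using step_iso_id by (simp add: id_def)
next
  case (Suc n)
  from step_iso_comp[OF step_iso_reassoc this] show ?case
    by (simp only: funpow_Suc_right right_comb.simps)
qed

lemma par_right_in_right_comb:
  "length Qs = Suc n \<Longrightarrow> par_right (par_list Qs) C \<in> right_comb n"
proof (induction n arbitrary: Qs C)
  case (Suc n)
  then obtain Q Qs' where "Qs = Q # Qs'" "length Qs' = Suc n" "Qs' \<noteq> []" by (auto simp: length_Suc_conv)
  with Suc.IH show ?case by (auto simp: par_list_Cons)
qed simp

text \<open>Each reassociation absorbs one component into the left operand; the last component is
  already in place, so \<open>n + 1\<close> components take \<open>n\<close> rounds.\<close>

lemma funpow_reassoc_par_right: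
  "length Qs = Suc n \<Longrightarrow> (reassoc ^^ n) (par_right (par_list Qs) C) = par_all Qs C"
proof (induction n arbitrary: Qs C)
  case 0
  then obtain Q where "Qs = [Q]" by (auto simp: length_Suc_conv)
  then show ?case by (cases C) simp
next
  case (Suc n)
  then obtain Q Qs' where "Qs = Q # Qs'" "length Qs' = Suc n" "Qs' \<noteq> []" by (auto simp: length_Suc_conv)
  moreover from this have "par_list Qs = Par Q (par_list Qs')" by (auto simp: par_list_Cons)
  ultimately show ?case
    using Suc.IH by (simp add: funpow_Suc_right par_all_Cons del: funpow.simps)
qed

text \<open>Recovers the components of a context of unknown shape: each round of reassociation
  exposes one more parallel composition in \<open>Q\<close>.\<close>

lemma right_comb_imp_par_list:
  "par_right Q C \<in> right_comb n \<Longrightarrow> \<exists>Qs. length Qs = Suc n \<and> Q = par_list Qs"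
proof (induction n arbitrary: Q C)
  case 0
  then show ?case by (intro exI[of _ "[Q]"]) simp
next
  case (Suc n)
  then obtain Q1 Q2 where Q: "Q = Par Q1 Q2" by (cases C) (auto simp: nested_par_def)
  with Suc.prems have "par_right Q2 (par_right Q1 C) \<in> right_comb n" by simp
  from Suc.IH[OF this] obtain Qs where Qs: "length Qs = Suc n" "Q2 = par_list Qs" by blast
  then have "Qs \<noteq> []" by auto
  with Q Qs show ?case by (intro exI[of _ "Q1 # Qs"]) (simp add: par_list_Cons)
qed

lemma map_funpow_reassoc_plug:
  assumes "length Qs = Suc n"
  shows "map_pmf (map_option (reassoc ^^ n)) (plug (Ctx \<Sigma> (par_list Qs)) \<Delta>) =
    map_pmf (map_option (par_all Qs)) \<Delta>"
  by (simp add: map_pmf_comp option.map_comp comp_def funpow_reassoc_par_right[OF assms])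

lemma admissible_par_all_iff:
  assumes "length Qs = Suc n"
  shows "admissible (map_pmf (map_option (par_all Qs)) \<Delta>) \<longleftrightarrow>
    admissible (plug (Ctx \<Sigma> (par_list Qs)) \<Delta>)"
proof -
  interpret step_iso "right_comb n" "reassoc ^^ n" by (rule step_iso_funpow_reassoc)
  have "set_pmf (plug (Ctx \<Sigma> (par_list Qs)) \<Delta>) \<subseteq> dom"
    using par_right_in_right_comb[OF assms] by (auto simp: dom_def)
  from admissible_map_iff[OF this] show ?thesis
    unfolding map_funpow_reassoc_plug[OF assms] .
qed

text \<open>The point \<open>C0\<close> pins down the hole of the outer context through unique
  typing; with only \<bottom> in the support, every hole would fit.\<close>

lemma plug_defined_snoc:
  assumes \<Delta>: "plug_defined (Ctx \<Sigma> (par_list Qs)) \<Delta>" and Qs: "Qs \<noteq> []"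
    and def: "plug_defined (Ctx \<Sigma>' Q) (map_pmf (map_option (par_all Qs)) \<Delta>)"
    and C0: "Some C0 \<in> set_pmf \<Delta>"
  shows "plug_defined (Ctx \<Sigma> (par_list (Qs @ [Q]))) \<Delta>"
proof -
  from \<Delta> obtain \<Sigma>1 where
    1: "ctx_typed \<Sigma>1 (Ctx \<Sigma> (par_list Qs))" and
    fit1: "\<And>C. Some C \<in> set_pmf \<Delta> \<Longrightarrow> hole_fits (Ctx \<Sigma> (par_list Qs)) \<Sigma>1 C"
    unfolding plug_defined_def by blast
  from def obtain \<Sigma>2 where
    2: "ctx_typed \<Sigma>2 (Ctx \<Sigma>' Q)" and
    fit2: "\<And>C. Some C \<in> set_pmf \<Delta> \<Longrightarrow> hole_fits (Ctx \<Sigma>' Q) \<Sigma>2 (par_all Qs C)"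
    unfolding plug_defined_def by (auto simp: Some_in_map_option_image)
  have "\<Sigma>1 = \<Sigma>'"
  proof -
    obtain S \<rho> P where C: "C0 = Conf S \<rho> P" by (cases C0)
    have "names \<Sigma> \<union> names (\<Sigma>1 - \<Sigma>) \<turnstile> Par P (par_list Qs)"
      using 1 fit1[OF C0] by (intro t_par) (auto simp: C)
    moreover have "names \<Sigma>' \<turnstile> Par P (par_list Qs)"
      using fit2[OF C0] Qs by (simp add: C has_type_foldl_Par)
    ultimately have "names \<Sigma> \<union> names (\<Sigma>1 - \<Sigma>) = names \<Sigma>'" by (rule has_type_unique)
    with 1 show ?thesis by (simp add: names_Un_Diff)
  qed
  have "names (\<Sigma>1 - \<Sigma>) \<union> names (\<Sigma>2 - \<Sigma>1) \<turnstile> par_list (Qs @ [Q])"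
    using 1 2 Qs \<open>\<Sigma>1 = \<Sigma>'\<close> by (intro has_type_par_list_snoc) auto
  moreover have "names (\<Sigma>1 - \<Sigma>) \<union> names (\<Sigma>2 - \<Sigma>1) = names (\<Sigma>2 - \<Sigma>)"
    using 1 2 \<open>\<Sigma>1 = \<Sigma>'\<close> by auto
  ultimately have "ctx_typed \<Sigma>2 (Ctx \<Sigma> (par_list (Qs @ [Q])))"
    using 1 2 \<open>\<Sigma>1 = \<Sigma>'\<close> Qs by (auto simp: closed_proc_def fv_par_list)
  moreover have "hole_fits (Ctx \<Sigma> (par_list (Qs @ [Q]))) \<Sigma>2 C" if "Some C \<in> set_pmf \<Delta>" for C
    using fit1[OF that] fit2[OF that] by (cases C) simp
  \<comment> \<open>The given admissibility concerns the left-nested form; the isomorphism carries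
    it to the flattened one.\<close>
  moreover have "admissible (plug (Ctx \<Sigma> (par_list (Qs @ [Q]))) \<Delta>)"
  proof -
    have "plug (Ctx \<Sigma>' Q) (map_pmf (map_option (par_all Qs)) \<Delta>) =
        map_pmf (map_option (par_all (Qs @ [Q]))) \<Delta>"
      by (simp add: map_pmf_comp option.map_comp comp_def flip: par_all_snoc)
    with def admissible_par_all_iff[of "Qs @ [Q]" "length Qs"] show ?thesis
      unfolding plug_defined_def by simp
  qed
  ultimately show ?thesis unfolding plug_defined_def by blast
qed


section \<open>The closure is a bisimulation\<close>

text \<open>Only the flattened context has to be admissible.  Partial contexts need not be: a process may
  receive qubits there that belong to the later components, and so violate deterministic tagging.\<close>

inductive par_closure :: "'t dist_rel \<Rightarrow> 't dist_rel" for R :: "'t dist_rel" where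
  base: "R \<Delta> \<Theta> \<Longrightarrow> par_closure R \<Delta> \<Theta>"
| par_all: "R \<Delta> \<Theta> \<Longrightarrow> Qs \<noteq> [] \<Longrightarrow>
    plug_defined (Ctx \<Sigma> (par_list Qs)) \<Delta> \<Longrightarrow> plug_defined (Ctx \<Sigma> (par_list Qs)) \<Theta> \<Longrightarrow>
    par_closure R (map_pmf (map_option (par_all Qs)) \<Delta>) (map_pmf (map_option (par_all Qs)) \<Theta>)"

lemma par_closure_converse: "par_closure (\<lambda>\<Delta> \<Theta>. R \<Theta> \<Delta>) \<Delta> \<Theta> \<longleftrightarrow> par_closure R \<Theta> \<Delta>"
  by (auto elim!: par_closure.cases intro: par_closure.intros)

lemma context_closure_converse:
  "context_closure (\<lambda>\<Delta> \<Theta>. R \<Theta> \<Delta>) \<Delta> \<Theta> \<longleftrightarrow> context_closure R \<Theta> \<Delta>"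
  by (auto elim!: context_closure.cases intro: context_closure.intros)

text \<open>The clauses of \<open>progress\<close> are mirror images and both closures commute with
  converse, so simulation can be proved in one direction only.\<close>

lemma upto_converse:
  assumes "saturated_bisimulation_upto_Cv_B R"
  shows "saturated_bisimulation_upto_Cv_B (\<lambda>\<Delta> \<Theta>. R \<Theta> \<Delta>)"
proof -
  have *: "convex_hull (context_closure (\<lambda>\<Delta> \<Theta>. R \<Theta> \<Delta>)) =
      (\<lambda>\<Delta> \<Theta>. convex_hull (context_closure R) \<Theta> \<Delta>)"
  proof (intro ext)
    fix \<Delta> \<Theta>
    have eq: "context_closure (\<lambda>\<Delta> \<Theta>. R \<Theta> \<Delta>) = (\<lambda>\<Delta> \<Theta>. context_closure R \<Theta> \<Delta>)"
      by (intro ext context_closure_converse)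
    show "convex_hull (context_closure (\<lambda>\<Delta> \<Theta>. R \<Theta> \<Delta>)) \<Delta> \<Theta> =
        convex_hull (context_closure R) \<Theta> \<Delta>"
      unfolding eq by (rule convex_hull_converse)
  qed
  show ?thesis
    unfolding saturated_bisimulation_upto_Cv_B_def *
  proof (intro allI impI)
    fix \<Delta> \<Theta> assume "R \<Theta> \<Delta>"
    with assms have p: "progress (convex_hull (context_closure R)) \<Theta> \<Delta>"
      unfolding saturated_bisimulation_upto_Cv_B_def by blast
    show "progress (\<lambda>\<Delta> \<Theta>. convex_hull (context_closure R) \<Theta> \<Delta>) \<Delta> \<Theta>"
      using p unfolding progress_def by (elim conjE; intro conjI) (simp_all, blast)
  qed
qed

lemma upto_progress:
  assumes "saturated_bisimulation_upto_Cv_B R" "R \<Delta> \<Theta>"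
  shows "admissible \<Delta>" "admissible \<Theta>" "mass \<Delta> = mass \<Theta>"
    and "\<exists>\<Sigma> \<Sigma>'. dist_typed \<Sigma> \<Sigma>' \<Delta> \<and> dist_typed \<Sigma> \<Sigma>' \<Theta>"
    and "plug_defined B \<Delta> \<Longrightarrow> plug_defined B \<Theta> \<Longrightarrow> dist_step (plug B \<Delta>) ATau \<delta> \<Delta>' \<Longrightarrow>
      \<exists>\<Theta>'. dist_step (plug B \<Theta>) ATau \<delta> \<Theta>' \<and> convex_hull (context_closure R) \<Delta>' \<Theta>'"
  using assms unfolding saturated_bisimulation_upto_Cv_B_def progress_def by blast+

lemma par_closure_admissible:
  assumes "saturated_bisimulation_upto_Cv_B R" "par_closure R \<Delta> \<Theta>"
  shows "admissible \<Delta>" "admissible \<Theta>"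
proof -
  have "admissible \<Delta> \<and> admissible \<Theta>"
    using assms(2)
  proof cases
    case base
    with upto_progress[OF assms(1)] show ?thesis by blast
  next
    case (par_all \<Delta>0 \<Theta>0 Qs \<Sigma>)
    from par_all(4) obtain n where "length Qs = Suc n" by (cases Qs) auto
    with admissible_par_all_iff par_all show ?thesis unfolding plug_defined_def by metis
  qed
  then show "admissible \<Delta>" "admissible \<Theta>" by simp_all
qed

text \<open>Contexts fix \<bottom> and so do not alter its probability.\<close>

lemma par_closure_mass:
  assumes "saturated_bisimulation_upto_Cv_B R" "par_closure R \<Delta> \<Theta>"
  shows "pmf \<Delta> None = pmf \<Theta> None"
  using assms(2)
proof cases
  case base
  with upto_progress(3)[OF assms(1)] show ?thesis by (auto simp: mass_def)
next
  case (par_all \<Delta>0 \<Theta>0 Qs \<Sigma>)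
  with upto_progress(3)[OF assms(1) par_all(3)] show ?thesis
    by (simp add: mass_def pmf_map_option_None)
qed

lemma par_closure_plug:
  assumes "R \<Delta> \<Theta>" "plug_defined B \<Delta>" "plug_defined B \<Theta>"
  shows "par_closure R (plug B \<Delta>) (plug B \<Theta>)"
proof -
  obtain \<Sigma> Q where B: "B = Ctx \<Sigma> Q" by (cases B)
  have "par_all [Q] = par_right Q"
    by (rule ext, rename_tac C, case_tac C) simp
  with par_closure.par_all[of R \<Delta> \<Theta> "[Q]" \<Sigma>] assms show ?thesis by (simp add: B)
qed

lemma convex_hull_par_closure:
  "convex_hull (context_closure R) \<Delta> \<Theta> \<Longrightarrow> convex_hull (par_closure R) \<Delta> \<Theta>"
  using convex_hull_mono[of "context_closure R" "par_closure R"]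
  by (auto elim!: context_closure.cases intro: par_closure_plug)

lemma dist_typed_imp_typed:
  "dist_typed \<Sigma> \<Sigma>' \<Delta> \<Longrightarrow> Some C \<in> set_pmf \<Delta> \<Longrightarrow> \<exists>\<Sigma> \<Sigma>'. conf_typed \<Sigma> \<Sigma>' C"
  by (auto simp: dist_typed_def)

lemma Some_in_set_pmf: "p \<noteq> return_pmf None \<Longrightarrow> \<exists>x. Some x \<in> set_pmf p"
  unfolding set_pmf_subset_singleton[symmetric] by (auto simp: subset_iff)

text \<open>The hypothesis on \<open>\<Delta>\<close> determines the shape of its context unless the hole only holds \<open>\<bottom>\<close>,
  and then \<open>\<Delta>\<close> and \<open>\<Theta>\<close> are the point distribution on \<open>\<bottom>\<close>.\<close>

lemma par_closure_regroup:
  assumes up: "saturated_bisimulation_upto_Cv_B R" and cc: "context_closure R \<Delta> \<Theta>"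
    and sub: "\<And>C. Some C \<in> set_pmf \<Delta> \<Longrightarrow> C \<in> right_comb n"
  shows "par_closure R (map_pmf (map_option (reassoc ^^ n)) \<Delta>) (map_pmf (map_option (reassoc ^^ n)) \<Theta>)"
  using cc
proof cases
  case (1 \<Delta>0 \<Theta>0 B)
  obtain \<Sigma> Q where B: "B = Ctx \<Sigma> Q" by (cases B)
  show ?thesis
  proof (cases "\<Delta>0 = return_pmf None")
    case True
    with upto_progress(3)[OF up 1(3)] have "\<Theta>0 = return_pmf None"
      by (simp add: mass_def flip: pmf_eq_1_iff)
    \<comment> \<open>Contexts and reassociation fix \<bottom>, so the resulting pair is the
      original one in \<open>R\<close>.\<close>
    with True par_closure.base[of R, OF 1(3)] show ?thesis by (simp add: 1(1,2) B)
  next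
    case False
    then obtain C where "Some C \<in> set_pmf \<Delta>0" by (blast dest: Some_in_set_pmf)
    then have "par_right Q C \<in> right_comb n"
      by (intro sub) (auto simp: 1(1) B Some_in_map_option_image)
    from right_comb_imp_par_list[OF this] obtain Qs where
      Qs: "length Qs = Suc n" "Q = par_list Qs" by blast
    then have "Qs \<noteq> []" by auto
    from par_closure.par_all[of R, OF 1(3) this, of \<Sigma>] 1(4,5) show ?thesis
      unfolding 1(1,2) B Qs(2) map_funpow_reassoc_plug[OF Qs(1)] by blast
  qed
qed

text \<open>In the iterated case the challenge travels backward along the isomorphism, by reflection
  of steps, and the answer travels forward.\<close>

lemma par_closure_simulates:
  fixes R :: "'t dist_rel"
  assumes up: "saturated_bisimulation_upto_Cv_B R" and pc: "par_closure R \<Delta> \<Theta>"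
    and def: "plug_defined B \<Delta>" "plug_defined B \<Theta>"
    and st: "dist_step (plug B \<Delta>) ATau \<delta> \<Delta>'"
  shows "\<exists>\<Theta>'. dist_step (plug B \<Theta>) ATau \<delta> \<Theta>' \<and> convex_hull (par_closure R) \<Delta>' \<Theta>'"
  using pc
proof cases
  case base
  from upto_progress(5)[OF up base def st] show ?thesis
    using convex_hull_par_closure by blast
next
  case (par_all \<Gamma> \<Lambda> Qs \<Sigma>)
  show ?thesis
  proof (cases "\<Gamma> = return_pmf None")
    case True
    with upto_progress(3)[OF up par_all(3)] have \<Lambda>: "\<Lambda> = return_pmf None"
      by (simp add: mass_def flip: pmf_eq_1_iff)
    have eq: "plug B \<Delta> = return_pmf None" "plug B \<Theta> = return_pmf None"
      by (cases B; simp add: par_all(1,2) True \<Lambda>)+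
    \<comment> \<open>A derivative other than \<bottom> would have to start from a configuration,
      and the support contains none.\<close>
    have "\<Delta>' = return_pmf None"
      using dist_step_target[OF st] Some_in_set_pmf[of \<Delta>'] unfolding eq by auto
    with par_closure.base[of R, OF par_all(3)] st eq True \<Lambda> show ?thesis
      by (auto intro!: exI[of _ "return_pmf None"] convex_hullI)
  next
    case False
    then obtain C1 where C1: "Some C1 \<in> set_pmf \<Gamma>" by (blast dest: Some_in_set_pmf)
    from False upto_progress(3)[OF up par_all(3)] have "\<Lambda> \<noteq> return_pmf None"
      by (simp add: mass_def flip: pmf_eq_1_iff)
    then obtain C2 where C2: "Some C2 \<in> set_pmf \<Lambda>" by (blast dest: Some_in_set_pmf)
    obtain \<Sigma>' Q where B: "B = Ctx \<Sigma>' Q" by (cases B)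
    \<comment> \<open>\<open>Qs @ [Q]\<close> has \<open>n + 1\<close> components, hence
      \<open>n\<close> reassociations.\<close>
    define n where "n = length Qs"
    define f where "f = (reassoc ^^ n :: 't conf \<Rightarrow> 't conf)"
    define B' where "B' = Ctx \<Sigma> (par_list (Qs @ [Q]))"
    interpret step_iso "right_comb n" f unfolding f_def by (rule step_iso_funpow_reassoc)
    have plug: "plug B (map_pmf (map_option (par_all Qs)) \<Xi>) = map_pmf (map_option f) (plug B' \<Xi>)" for \<Xi>
      unfolding B B'_def f_def
      by (subst map_funpow_reassoc_plug)
        (simp_all add: n_def map_pmf_comp option.map_comp comp_def flip: par_all_snoc)
    have def': "plug_defined B' \<Gamma>" "plug_defined B' \<Lambda>"
      using plug_defined_snoc[OF par_all(5,4) _ C1] plug_defined_snoc[OF par_all(6,4) _ C2] def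
      by (simp_all add: B B'_def par_all(1,2))
    have dom: "set_pmf (plug B' \<Xi>) \<subseteq> dom" for \<Xi>
    proof -
      have "length (Qs @ [Q]) = Suc n" by (simp add: n_def)
      from par_right_in_right_comb[OF this] show ?thesis by (auto simp: dom_def B'_def)
    qed
    have td: "set_pmf (plug B' \<Xi>) \<subseteq> typed_dom" if "plug_defined B' \<Xi>" for \<Xi>
      using that dom[of \<Xi>] dist_typed_imp_typed
      unfolding plug_defined_def admissible_def typed_dom_def by blast
    from dist_step_map_inv[OF td[OF def'(1)]] st obtain \<Delta>0 where
      \<Delta>0: "dist_step (plug B' \<Gamma>) ATau \<delta> \<Delta>0" "\<Delta>' = map_pmf (map_option f) \<Delta>0"
      unfolding par_all(1) plug by blast
    from upto_progress(5)[OF up par_all(3) def' \<Delta>0(1)] obtain \<Theta>0 where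
      \<Theta>0: "dist_step (plug B' \<Lambda>) ATau \<delta> \<Theta>0" "convex_hull (context_closure R) \<Delta>0 \<Theta>0" by blast
    have "dist_step (plug B \<Theta>) ATau \<delta> (map_pmf (map_option f) \<Theta>0)"
      unfolding par_all(2) plug by (rule dist_step_map(2)[OF td[OF def'(2)] \<Theta>0(1)])
    moreover have "convex_hull (par_closure R) (map_pmf (map_option f) \<Delta>0) (map_pmf (map_option f) \<Theta>0)"
      using \<Theta>0(2)
    proof cases
      case (1 I A A')
      have "par_closure R (map_pmf (map_option f) (A i)) (map_pmf (map_option f) (A' i))"
        if i: "i \<in> set_pmf I" for i
        unfolding f_def
      proof (rule par_closure_regroup[OF up])
        show "context_closure R (A i) (A' i)" using 1(4) i by blast
        \<comment> \<open>The step stays in the domain of the isomorphism, and the components have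
          smaller supports; this reveals the shape of each context, which is common to both sides of
          the pair.\<close>
        fix C assume "Some C \<in> set_pmf (A i)"
        with i 1(1) have "Some C \<in> set_pmf \<Delta>0" by auto
        with dist_step_map(1)[OF td[OF def'(1)] \<Delta>0(1)] show "C \<in> right_comb n"
          by (auto simp: dom_def)
      qed
      with 1 show ?thesis by (auto simp: map_bind_pmf intro!: convex_hull.intros)
    qed
    ultimately show ?thesis using \<Delta>0(2) by blast
  qed
qed

text \<open>Components can be tested separately: their supports lie in that of the whole, so all
  their points step and the context stays defined. The answers are all given by one kernel and
  therefore recombine.\<close>

lemma convex_hull_par_closure_simulates:
  assumes up: "saturated_bisimulation_upto_Cv_B R" and ch: "convex_hull (par_closure R) \<Delta> \<Theta>"
    and def: "plug_defined B \<Delta>" "plug_defined B \<Theta>"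
    and st: "dist_step (plug B \<Delta>) ATau \<delta> \<Delta>'"
  shows "\<exists>\<Theta>'. dist_step (plug B \<Theta>) ATau \<delta> \<Theta>' \<and> convex_hull (par_closure R) \<Delta>' \<Theta>'"
  using ch
proof cases
  case (1 I D T)
  let ?F = "derivative ATau \<delta>"
  have det: "deterministically_tagged (plug B \<Delta>)" "deterministically_tagged (plug B \<Theta>)"
    and fin: "finite (set_pmf (plug B \<Delta>))" "finite (set_pmf (plug B \<Theta>))"
    using def by (simp_all add: plug_defined_def admissible_def)
  note der = dist_step_derivative[OF det(1) subset_refl st]
  have main: "convex_hull (par_closure R) (bind_pmf (plug B (D i)) ?F) (bind_pmf (plug B (T i)) ?F) \<and>
      (\<forall>X \<in> set_pmf (plug B (T i)). sched_step X ATau \<delta> (?F X))" if i: "i \<in> set_pmf I" for i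
  proof -
    have sub: "set_pmf (D i) \<subseteq> set_pmf \<Delta>" "set_pmf (T i) \<subseteq> set_pmf \<Theta>"
      using 1 i by auto
    have psub: "set_pmf (plug B (D i)) \<subseteq> set_pmf (plug B \<Delta>)"
        "set_pmf (plug B (T i)) \<subseteq> set_pmf (plug B \<Theta>)"
      using 1 i by (auto simp: plug_bind)
    have "dist_step (plug B (D i)) ATau \<delta> (bind_pmf (plug B (D i)) ?F)"
      using der(2) psub(1) fin(1) by (intro dist_stepI) (auto intro: finite_subset)
    with par_closure_simulates[OF up _ plug_defined_subset[OF def(1) sub(1)]
        plug_defined_subset[OF def(2) sub(2)]] 1(4) i
    obtain T' where T': "dist_step (plug B (T i)) ATau \<delta> T'"
      "convex_hull (par_closure R) (bind_pmf (plug B (D i)) ?F) T'" by blast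
    \<comment> \<open>Determinism of \<open>plug B \<Theta>\<close> forces the answer to be the bind
      along \<open>?F\<close>.\<close>
    from dist_step_derivative[OF det(2) psub(2) T'(1)] T'(2) show ?thesis by simp
  qed
  have "dist_step (plug B \<Theta>) ATau \<delta> (bind_pmf (plug B \<Theta>) ?F)"
    using main fin(2) by (intro dist_stepI) (auto simp: 1(2) plug_bind)
  moreover have "convex_hull (par_closure R) (bind_pmf (plug B \<Delta>) ?F) (bind_pmf (plug B \<Theta>) ?F)"
    unfolding 1(1,2) plug_bind bind_assoc_pmf using 1(3) main by (intro convex_hull_bind) auto
  ultimately show ?thesis using der(1) by blast
qed

text \<open>The components may have different types, so only the typing of individual points is
  inherited from them.\<close>

lemma convex_hull_par_closure_typed:
  assumes "saturated_bisimulation_upto_Cv_B R" "convex_hull (par_closure R) \<Delta> \<Theta>"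
  shows "mass \<Delta> = mass \<Theta>" "finite (set_pmf \<Delta>)" "finite (set_pmf \<Theta>)"
    and "Some C \<in> set_pmf \<Delta> \<Longrightarrow> \<exists>\<Sigma> \<Sigma>'. conf_typed \<Sigma> \<Sigma>' C"
    and "Some C \<in> set_pmf \<Theta> \<Longrightarrow> \<exists>\<Sigma> \<Sigma>'. conf_typed \<Sigma> \<Sigma>' C"
proof -
  from assms(2) obtain I D T where 1: "\<Delta> = bind_pmf I D" "\<Theta> = bind_pmf I T"
    "finite (set_pmf (I :: nat pmf))" "\<And>i. i \<in> set_pmf I \<Longrightarrow> par_closure R (D i) (T i)"
    by cases auto
  note adm = par_closure_admissible[OF assms(1) 1(4)]
  show "mass \<Delta> = mass \<Theta>"
    unfolding mass_def 1(1,2) pmf_bind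
    using par_closure_mass[OF assms(1) 1(4)]
    by (auto intro!: Bochner_Integration.integral_cong_AE simp: AE_measure_pmf_iff)
  show "finite (set_pmf \<Delta>)" "finite (set_pmf \<Theta>)"
    using adm 1(3) by (auto simp: 1(1,2) admissible_def)
  show "Some C \<in> set_pmf \<Delta> \<Longrightarrow> \<exists>\<Sigma> \<Sigma>'. conf_typed \<Sigma> \<Sigma>' C"
    "Some C \<in> set_pmf \<Theta> \<Longrightarrow> \<exists>\<Sigma> \<Sigma>'. conf_typed \<Sigma> \<Sigma>' C"
    using adm dist_typed_imp_typed by (auto simp: 1(1,2) admissible_def) blast+
qed

text \<open>A combination of admissible pairs may lack determinism or a common type. Both are
  recorded for the combination as a whole, where transitions preserve them.\<close>

definition upto_closure :: "'t dist_rel \<Rightarrow> 't dist_rel" where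
  "upto_closure R \<Delta> \<Theta> \<longleftrightarrow> admissible \<Delta> \<and> admissible \<Theta> \<and>
     (\<exists>\<Sigma> \<Sigma>'. dist_typed \<Sigma> \<Sigma>' \<Delta> \<and> dist_typed \<Sigma> \<Sigma>' \<Theta>) \<and> convex_hull (par_closure R) \<Delta> \<Theta>"

text \<open>Individual typing of the targets comes from the hull; the common type and determinism
  come from the plugged sources.\<close>

lemma upto_closure_derivative:
  assumes up: "saturated_bisimulation_upto_Cv_B R" and uc: "upto_closure R \<Delta> \<Theta>"
    and def: "plug_defined B \<Delta>" "plug_defined B \<Theta>"
    and st: "dist_step (plug B \<Delta>) ATau \<delta> \<Delta>'" "dist_step (plug B \<Theta>) ATau \<delta> \<Theta>'"
    and ch: "convex_hull (par_closure R) \<Delta>' \<Theta>'"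
  shows "upto_closure R \<Delta>' \<Theta>'"
proof -
  note t = convex_hull_par_closure_typed[OF up ch]
  from uc obtain \<Sigma>0 \<Sigma>0' where "dist_typed \<Sigma>0 \<Sigma>0' \<Delta>" "dist_typed \<Sigma>0 \<Sigma>0' \<Theta>"
    unfolding upto_closure_def by blast
  from plug_common_type[OF this def] obtain \<Sigma> \<Sigma>' where
    "dist_typed \<Sigma> \<Sigma>' (plug B \<Delta>)" "dist_typed \<Sigma> \<Sigma>' (plug B \<Theta>)" by blast
  then have "dist_typed \<Sigma> \<Sigma>' \<Delta>'" "dist_typed \<Sigma> \<Sigma>' \<Theta>'"
    using dist_step_typed[OF st(1) _ t(4)] dist_step_typed[OF st(2) _ t(5)] by blast+
  moreover have "deterministically_tagged \<Delta>'" "deterministically_tagged \<Theta>'"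
    using dist_step_deterministically_tagged[OF st(1) _ t(4)]
      dist_step_deterministically_tagged[OF st(2) _ t(5)] def
    unfolding plug_defined_def admissible_def by blast+
  ultimately show ?thesis
    using t(2,3) ch unfolding upto_closure_def admissible_def by blast
qed

lemma saturated_bisimulation_upto_closure:
  assumes up: "saturated_bisimulation_upto_Cv_B R"
  shows "saturated_bisimulation (upto_closure R)"
  unfolding saturated_bisimulation_def
proof (intro allI impI)
  fix \<Delta> \<Theta> assume uc: "upto_closure R \<Delta> \<Theta>"
  then have ch: "convex_hull (par_closure R) \<Delta> \<Theta>" by (simp add: upto_closure_def)
  have conv: "convex_hull (par_closure (\<lambda>\<Delta> \<Theta>. R \<Theta> \<Delta>)) \<Delta> \<Theta> \<longleftrightarrow> convex_hull (par_closure R) \<Theta> \<Delta>"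
    for \<Delta> \<Theta>
  proof -
    have eq: "par_closure (\<lambda>\<Delta> \<Theta>. R \<Theta> \<Delta>) = (\<lambda>\<Delta> \<Theta>. par_closure R \<Theta> \<Delta>)"
      by (intro ext par_closure_converse)
    show ?thesis unfolding eq by (rule convex_hull_converse)
  qed
  show "progress (upto_closure R) \<Delta> \<Theta>"
    unfolding progress_def
  proof (intro conjI allI impI)
    show "admissible \<Delta>" "admissible \<Theta>" "\<exists>\<Sigma> \<Sigma>'. dist_typed \<Sigma> \<Sigma>' \<Delta> \<and> dist_typed \<Sigma> \<Sigma>' \<Theta>"
      using uc by (simp_all add: upto_closure_def)
    show "mass \<Delta> = mass \<Theta>" using convex_hull_par_closure_typed(1)[OF up ch] .
  next
    fix B \<delta> \<Delta>' assume def: "plug_defined B \<Delta>" "plug_defined B \<Theta>"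
      and st: "dist_step (plug B \<Delta>) ATau \<delta> \<Delta>'"
    from convex_hull_par_closure_simulates[OF up ch def st]
    show "\<exists>\<Theta>'. dist_step (plug B \<Theta>) ATau \<delta> \<Theta>' \<and> upto_closure R \<Delta>' \<Theta>'"
      using upto_closure_derivative[OF up uc def st] by blast
  next
    fix B \<delta> \<Theta>' assume def: "plug_defined B \<Delta>" "plug_defined B \<Theta>"
      and st: "dist_step (plug B \<Theta>) ATau \<delta> \<Theta>'"
    \<comment> \<open>A challenge from the right is one from the left for the converse of
      \<open>R\<close>; \<open>conv\<close> translates the hull back.\<close>
    from convex_hull_par_closure_simulates[OF upto_converse[OF up], unfolded conv, OF ch def(2,1) st]
    show "\<exists>\<Delta>'. dist_step (plug B \<Delta>) ATau \<delta> \<Delta>' \<and> upto_closure R \<Delta>' \<Theta>'"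
      using upto_closure_derivative[OF up uc def _ st] by blast
  qed
qed

theorem theorem6:
  fixes R :: "'t dist_rel" and \<Delta> \<Theta> :: "'t dist"
  assumes "saturated_bisimulation_upto_Cv_B R"
    and "R \<Delta> \<Theta>"
  shows "\<Delta> \<sim>\<^sub>s \<Theta>"
proof -
  \<comment> \<open>The pair enters as a one-point combination without any context.\<close>
  have "upto_closure R \<Delta> \<Theta>"
    unfolding upto_closure_def
    using upto_progress[OF assms] convex_hullI[of "par_closure R", OF par_closure.base[of R, OF assms(2)]]
    by blast
  with saturated_bisimulation_upto_closure[OF assms(1)] show ?thesis
    unfolding saturated_bisimilar_def by blast
qed

end
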